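(* Let $\hbar>0$ and let $V:\hbar\mathbb{Z}^n\to\mathbb{R}$ satisfy $V\ge 0$ and $|V(k)|\to\infty$ as $|k|\to\infty$. Then the discrete Schrödinger operator $\mathcal{H}_{\hbar,V}=-\hbar^{-2}\mathcal{L}_\hbar+V$, regarded as a self-adjoint operator in $\ell^2(\hbar\mathbb{Z}^n)$, has a purely discrete spectrum.
   Context: $\hbar\mathbb{Z}^n=\{\hbar k:k\in\mathbb{Z}^n\}\subset\mathbb{R}^n$, and $v_j$ is the $j$-th standard basis vector of $\mathbb{Z}^n$. The space $\ell^2(\hbar\mathbb{Z}^n)$ carries the inner product $(f,g)=\sum_{k\in\hbar\mathbb{Z}^n}f(k)\overline{g(k)}$. The discrete Laplacian is $\mathcal{L}_\hbar u(k)=\sum_{j=1}^n\big(u(k+\hbar v_j)+u(k-\hbar v_j)\big)-2n\,u(k)$, and $V$ acts by multiplication by $V(k)$. The operator is $\mathcal{H}_{\hbar,V}u(k)=-\hbar^{-2}\mathcal{L}_\hbar u(k)+V(k)u(k)$ with domain $\mathrm{Dom}(\mathcal{H}_{\hbar,V})=\{u\in\ell^2(\hbar\mathbb{Z}^n):(I+\mathcal{H}_{\hbar,V})u\in\ell^2(\hbar\mathbb{Z}^n)\}$. "Purely discrete spectrum" means that the essential spectrum $\sigma_{\mathrm{ess}}(\mathcal{H}_{\hbar,V})$ is empty (equivalently, $(\mathcal{H}_{\hbar,V}+I)^{-1}$ is compact). *)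

theory Defs
  imports "HOL-Analysis.Analysis"
begin

section \<open>The Hilbert space of square-summable functions on a set\<close>

text \<open>Functions on a set \<open>S\<close> are represented by functions on the ambient type that vanish
  off \<open>S\<close>, so that equality of functions is equality on \<open>S\<close>.\<close>

definition ell2 :: "'a set \<Rightarrow> ('a \<Rightarrow> complex) set" where
  "ell2 S = {f. (\<forall>k. k \<notin> S \<longrightarrow> f k = 0) \<and> (\<lambda>k. (cmod (f k))\<^sup>2) summable_on S}"

definition ell2_inner :: "'a set \<Rightarrow> ('a \<Rightarrow> complex) \<Rightarrow> ('a \<Rightarrow> complex) \<Rightarrow> complex" where
  "ell2_inner S f g = (\<Sum>\<^sub>\<infinity>k\<in>S. f k * cnj (g k))"

definition ell2_norm :: "'a set \<Rightarrow> ('a \<Rightarrow> complex) \<Rightarrow> real" where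
  "ell2_norm S f = sqrt (Re (ell2_inner S f f))"


section \<open>Unbounded operators\<close>

text \<open>An unbounded operator in \<open>ell2 S\<close> is given by a domain \<open>D \<subseteq> ell2 S\<close> and a map \<open>A\<close>, of which
  only the values on \<open>D\<close> matter.\<close>

definition densely_defined :: "'a set \<Rightarrow> ('a \<Rightarrow> complex) set \<Rightarrow> bool" where
  "densely_defined S D \<longleftrightarrow>
     D \<subseteq> ell2 S \<and> (\<forall>f\<in>ell2 S. \<forall>e>0. \<exists>u\<in>D. ell2_norm S (\<lambda>k. f k - u k) < e)"

definition adjoint_graph ::
  "'a set \<Rightarrow> ('a \<Rightarrow> complex) set \<Rightarrow> (('a \<Rightarrow> complex) \<Rightarrow> 'a \<Rightarrow> complex)
     \<Rightarrow> (('a \<Rightarrow> complex) \<times> ('a \<Rightarrow> complex)) set" where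
  "adjoint_graph S D A =
     {(v, w). v \<in> ell2 S \<and> w \<in> ell2 S \<and> (\<forall>u\<in>D. ell2_inner S (A u) v = ell2_inner S u w)}"

text \<open>Equality of an operator with its adjoint, as an equality of graphs. It includes that
  \<open>D\<close> is a subspace and that \<open>A\<close> is linear from \<open>D\<close> into \<open>ell2 S\<close>.\<close>

definition self_adjoint ::
  "'a set \<Rightarrow> ('a \<Rightarrow> complex) set \<Rightarrow> (('a \<Rightarrow> complex) \<Rightarrow> 'a \<Rightarrow> complex) \<Rightarrow> bool" where
  "self_adjoint S D A \<longleftrightarrow>
     densely_defined S D \<and> adjoint_graph S D A = {(u, A u) | u. u \<in> D}"

text \<open>The bound in the second conjunct says that the inverse of \<open>A - z\<close> is bounded.\<close>

definition resolvent_set ::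
  "'a set \<Rightarrow> ('a \<Rightarrow> complex) set \<Rightarrow> (('a \<Rightarrow> complex) \<Rightarrow> 'a \<Rightarrow> complex) \<Rightarrow> complex set" where
  "resolvent_set S D A =
     {z. bij_betw (\<lambda>u k. A u k - z * u k) D (ell2 S) \<and>
         (\<exists>C. \<forall>u\<in>D. ell2_norm S u \<le> C * ell2_norm S (\<lambda>k. A u k - z * u k))}"

definition op_spectrum ::
  "'a set \<Rightarrow> ('a \<Rightarrow> complex) set \<Rightarrow> (('a \<Rightarrow> complex) \<Rightarrow> 'a \<Rightarrow> complex) \<Rightarrow> complex set" where
  "op_spectrum S D A = - resolvent_set S D A"

definition op_eigenspace ::
  "('a \<Rightarrow> complex) set \<Rightarrow> (('a \<Rightarrow> complex) \<Rightarrow> 'a \<Rightarrow> complex) \<Rightarrow> complex \<Rightarrow> ('a \<Rightarrow> complex) set" where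
  "op_eigenspace D A z = {u \<in> D. A u = (\<lambda>k. z * u k)}"

definition finite_dimensional :: "('a \<Rightarrow> complex) set \<Rightarrow> bool" where
  "finite_dimensional E \<longleftrightarrow>
     (\<exists>B. finite B \<and> B \<subseteq> E \<and> (\<forall>u\<in>E. \<exists>c. u = (\<lambda>k. \<Sum>b\<in>B. c b * b k)))"

text \<open>For a self-adjoint operator the discrete spectrum consists of the isolated points of the
  spectrum that are eigenvalues of finite multiplicity, and the essential spectrum is the rest of
  the spectrum.\<close>

definition discrete_spectrum ::
  "'a set \<Rightarrow> ('a \<Rightarrow> complex) set \<Rightarrow> (('a \<Rightarrow> complex) \<Rightarrow> 'a \<Rightarrow> complex) \<Rightarrow> complex set" where
  "discrete_spectrum S D A =
     {z. z isolated_in op_spectrum S D A \<and>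
         (\<exists>u\<in>op_eigenspace D A z. u \<noteq> (\<lambda>k. 0)) \<and> finite_dimensional (op_eigenspace D A z)}"

definition essential_spectrum ::
  "'a set \<Rightarrow> ('a \<Rightarrow> complex) set \<Rightarrow> (('a \<Rightarrow> complex) \<Rightarrow> 'a \<Rightarrow> complex) \<Rightarrow> complex set" where
  "essential_spectrum S D A = op_spectrum S D A - discrete_spectrum S D A"

definition purely_discrete_spectrum ::
  "'a set \<Rightarrow> ('a \<Rightarrow> complex) set \<Rightarrow> (('a \<Rightarrow> complex) \<Rightarrow> 'a \<Rightarrow> complex) \<Rightarrow> bool" where
  "purely_discrete_spectrum S D A \<longleftrightarrow> essential_spectrum S D A = {}"


section \<open>The discrete Schroedinger operator\<close>

definition lattice_points :: "real \<Rightarrow> (real ^ 'n) set" where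
  "lattice_points h = {h *\<^sub>R k | k. \<forall>j. k $ j \<in> \<int>}"

definition discrete_laplacian ::
  "real \<Rightarrow> (real ^ 'n \<Rightarrow> complex) \<Rightarrow> real ^ 'n \<Rightarrow> complex" where
  "discrete_laplacian h u k =
     (\<Sum>j\<in>UNIV. u (k + h *\<^sub>R axis j 1) + u (k - h *\<^sub>R axis j 1)) - 2 * of_nat CARD('n) * u k"

text \<open>If \<open>u\<close> vanishes off the lattice, so does \<open>schroedinger h V u\<close>; the values of \<open>V\<close> off the
  lattice are irrelevant.\<close>

definition schroedinger ::
  "real \<Rightarrow> (real ^ 'n \<Rightarrow> real) \<Rightarrow> (real ^ 'n \<Rightarrow> complex) \<Rightarrow> real ^ 'n \<Rightarrow> complex" where
  "schroedinger h V u k =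
     - complex_of_real (1 / h\<^sup>2) * discrete_laplacian h u k + complex_of_real (V k) * u k"

definition schroedinger_dom ::
  "real \<Rightarrow> (real ^ 'n \<Rightarrow> real) \<Rightarrow> (real ^ 'n \<Rightarrow> complex) set" where
  "schroedinger_dom h V =
     {u \<in> ell2 (lattice_points h). (\<lambda>k. u k + schroedinger h V u k) \<in> ell2 (lattice_points h)}"

end

theory Submission
  imports Defs "HOL-Complex_Analysis.Great_Picard"
begin

text \<open>
  The Laplacian is bounded, symmetric and of finite range, so a bound on \<open>u\<close> and \<open>H u\<close> in
  \<open>\<ell>\<^sup>2\<close> bounds \<open>V u\<close>. As \<open>|V|\<close> tends to infinity, the tails of \<open>u\<close> are then uniformly small,
  and a diagonal subsequence converges in norm: the graph norm embeds compactly.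
  For a self-adjoint operator, this compactness replaces the spectral theorem. If \<open>z\<close> is not an
  eigenvalue, then \<open>H - z\<close> is bounded below, and it is onto because a least squares solution of
  \<open>(H - z) u = f\<close> exists and its residual would be an eigenvector for the conjugate of \<open>z\<close>. So the
  spectrum consists of eigenvalues. They are isolated, since unit eigenvectors for a convergent
  sequence of other eigenvalues would have a limit orthogonal to themselves. An eigenvector is
  determined by its values on a finite set, which bounds the multiplicity.
\<close>

section \<open>Square-summable functions\<close>

text \<open>The norm is defined through a complex infinite sum. Passing to the real sum of squares
  makes monotonicity arguments available.\<close>

lemma ell2_norm_power2:
  assumes "f \<in> ell2 S"
  shows "(ell2_norm S f)\<^sup>2 = (\<Sum>\<^sub>\<infinity>k\<in>S. (cmod (f k))\<^sup>2)"
    and ell2_inner_self: "ell2_inner S f f = complex_of_real ((ell2_norm S f)\<^sup>2)"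
proof -
  have "((\<lambda>k. (cmod (f k))\<^sup>2) has_sum (\<Sum>\<^sub>\<infinity>k\<in>S. (cmod (f k))\<^sup>2)) S"
    using assms by (simp add: ell2_def)
  then have "((\<lambda>k. complex_of_real ((cmod (f k))\<^sup>2)) has_sum
      complex_of_real (\<Sum>\<^sub>\<infinity>k\<in>S. (cmod (f k))\<^sup>2)) S"
    by (rule has_sum_of_real)
  then have *: "ell2_inner S f f = complex_of_real (\<Sum>\<^sub>\<infinity>k\<in>S. (cmod (f k))\<^sup>2)"
    unfolding ell2_inner_def complex_norm_square by (rule infsumI)
  then show "(ell2_norm S f)\<^sup>2 = (\<Sum>\<^sub>\<infinity>k\<in>S. (cmod (f k))\<^sup>2)"
    by (simp add: ell2_norm_def infsum_nonneg)
  with * show "ell2_inner S f f = complex_of_real ((ell2_norm S f)\<^sup>2)"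
    by simp
qed

lemma ell2_outside: "f \<in> ell2 S \<Longrightarrow> k \<notin> S \<Longrightarrow> f k = 0"
  by (simp add: ell2_def)

lemma L2_set_le_iff: "0 \<le> C \<Longrightarrow> L2_set g F \<le> C \<longleftrightarrow> (\<Sum>k\<in>F. (g k)\<^sup>2) \<le> C\<^sup>2"
  unfolding L2_set_def by (metis abs_of_nonneg real_sqrt_abs real_sqrt_le_iff)

lemma ell2_norm_nonneg [simp]:
  assumes "f \<in> ell2 S"
  shows "0 \<le> ell2_norm S f"
proof -
  have "0 \<le> Re (ell2_inner S f f)"
    unfolding ell2_inner_self[OF assms] by simp
  then show ?thesis by (simp add: ell2_norm_def)
qed

lemma L2_set_le_ell2_norm:
  assumes "f \<in> ell2 S" "finite F" "F \<subseteq> S"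
  shows "L2_set (\<lambda>k. cmod (f k)) F \<le> ell2_norm S f"
proof -
  have "(\<Sum>k\<in>F. (cmod (f k))\<^sup>2) \<le> (\<Sum>\<^sub>\<infinity>k\<in>S. (cmod (f k))\<^sup>2)"
    using assms by (intro finite_sum_le_infsum) (auto simp: ell2_def)
  with assms show ?thesis
    by (simp add: L2_set_le_iff ell2_norm_power2)
qed

text \<open>With \<open>L2_set_le_ell2_norm\<close> this exhibits the norm as the supremum of the
  norms over finite subsets. Membership and the estimate come from the same bound, so finite
  inequalities transfer to sums, limits and truncations.\<close>

lemma ell2_bounded:
  assumes "\<And>k. k \<notin> S \<Longrightarrow> f k = 0"
    and C: "\<And>F. finite F \<Longrightarrow> F \<subseteq> S \<Longrightarrow> L2_set (\<lambda>k. cmod (f k)) F \<le> C"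
  shows "f \<in> ell2 S" "ell2_norm S f \<le> C"
proof -
  have C0: "0 \<le> C" using C[of "{}"] by simp
  have le: "(\<Sum>k\<in>F. (cmod (f k))\<^sup>2) \<le> C\<^sup>2" if "finite F" "F \<subseteq> S" for F
    using C[OF that] by (simp add: L2_set_le_iff[OF C0])
  have "(\<lambda>k. (cmod (f k))\<^sup>2) summable_on S"
    by (rule nonneg_bdd_above_summable_on) (auto intro!: bdd_aboveI2 le)
  then show f: "f \<in> ell2 S" using assms(1) by (simp add: ell2_def)
  have "(ell2_norm S f)\<^sup>2 \<le> C\<^sup>2"
    unfolding ell2_norm_power2[OF f] using f le
    by (intro infsum_le_finite_sums) (auto simp: ell2_def)
  then show "ell2_norm S f \<le> C" using C0 by (rule power2_le_imp_le)
qed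

lemma ell2_zero [simp]: "(\<lambda>k. 0) \<in> ell2 S"
  by (simp add: ell2_def)

text \<open>Minkowski's inequality on a finite set. Both closure under addition and the triangle
  inequality follow by \<open>ell2_bounded\<close>.\<close>

lemma ell2_add_aux:
  assumes "f \<in> ell2 S" "g \<in> ell2 S" "finite F" "F \<subseteq> S"
  shows "L2_set (\<lambda>k. cmod (f k + g k)) F \<le> ell2_norm S f + ell2_norm S g"
proof -
  have "L2_set (\<lambda>k. cmod (f k + g k)) F \<le> L2_set (\<lambda>k. cmod (f k) + cmod (g k)) F"
    by (intro L2_set_mono) (auto simp: norm_triangle_ineq)
  also have "\<dots> \<le> L2_set (\<lambda>k. cmod (f k)) F + L2_set (\<lambda>k. cmod (g k)) F"
    by (rule L2_set_triangle_ineq)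
  also have "\<dots> \<le> ell2_norm S f + ell2_norm S g"
    by (intro add_mono L2_set_le_ell2_norm assms)
  finally show ?thesis .
qed

lemma ell2_add [simp]: "f \<in> ell2 S \<Longrightarrow> g \<in> ell2 S \<Longrightarrow> (\<lambda>k. f k + g k) \<in> ell2 S"
  by (rule ell2_bounded(1)[OF _ ell2_add_aux]) (auto simp: ell2_outside)

lemma ell2_norm_triangle:
  "f \<in> ell2 S \<Longrightarrow> g \<in> ell2 S \<Longrightarrow> ell2_norm S (\<lambda>k. f k + g k) \<le> ell2_norm S f + ell2_norm S g"
  by (rule ell2_bounded(2)[OF _ ell2_add_aux]) (auto simp: ell2_outside)

lemma ell2_scale [simp]: "f \<in> ell2 S \<Longrightarrow> (\<lambda>k. c * f k) \<in> ell2 S"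
  by (auto simp: ell2_def norm_mult power_mult_distrib intro: summable_on_cmult_right)

lemma ell2_norm_scale [simp]: "ell2_norm S (\<lambda>k. c * f k) = cmod c * ell2_norm S f"
proof -
  have "ell2_inner S (\<lambda>k. c * f k) (\<lambda>k. c * f k) = (c * cnj c) * ell2_inner S f f"
    unfolding ell2_inner_def by (subst infsum_cmult_right'[symmetric]) (simp add: algebra_simps)
  then show ?thesis
    by (simp add: ell2_norm_def complex_norm_square[symmetric] real_sqrt_mult
        del: of_real_power)
qed

lemma ell2_minus [simp]: "f \<in> ell2 S \<Longrightarrow> (\<lambda>k. - f k) \<in> ell2 S"
  using ell2_scale[of f S "-1"] by simp

lemma ell2_norm_minus [simp]: "ell2_norm S (\<lambda>k. - f k) = ell2_norm S f"
  using ell2_norm_scale[of S "-1" f] by simp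

lemma ell2_diff [simp]: "f \<in> ell2 S \<Longrightarrow> g \<in> ell2 S \<Longrightarrow> (\<lambda>k. f k - g k) \<in> ell2 S"
  using ell2_add[of f S "\<lambda>k. - g k"] by simp

lemma ell2_norm_triangle_diff:
  "f \<in> ell2 S \<Longrightarrow> g \<in> ell2 S \<Longrightarrow> ell2_norm S (\<lambda>k. f k - g k) \<le> ell2_norm S f + ell2_norm S g"
  using ell2_norm_triangle[of f S "\<lambda>k. - g k"] by simp

lemma ell2_sum [simp]:
  "(\<And>i. i \<in> I \<Longrightarrow> f i \<in> ell2 S) \<Longrightarrow> (\<lambda>k. \<Sum>i\<in>I. f i k) \<in> ell2 S"
  by (induction I rule: infinite_finite_induct) auto

lemma ell2_norm_zero [simp]: "ell2_norm S (\<lambda>k. 0) = 0"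
  by (simp add: ell2_norm_def ell2_inner_def)

lemma ell2_norm_sum:
  "(\<And>i. i \<in> I \<Longrightarrow> f i \<in> ell2 S) \<Longrightarrow>
    ell2_norm S (\<lambda>k. \<Sum>i\<in>I. f i k) \<le> (\<Sum>i\<in>I. ell2_norm S (f i))"
proof (induction I rule: infinite_finite_induct)
  case (insert i I)
  have "ell2_norm S (\<lambda>k. f i k + (\<Sum>i\<in>I. f i k)) \<le> ell2_norm S (f i) + ell2_norm S (\<lambda>k. \<Sum>i\<in>I. f i k)"
    using insert by (intro ell2_norm_triangle) auto
  with insert show ?case by fastforce
qed auto

lemma norm_le_ell2_norm:
  assumes "f \<in> ell2 S"
  shows "cmod (f k) \<le> ell2_norm S f"
proof (cases "k \<in> S")
  case True
  with L2_set_le_ell2_norm[OF assms, of "{k}"] show ?thesis by simp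
qed (use assms in \<open>simp add: ell2_outside\<close>)

lemma ell2_norm_eq_0:
  assumes "f \<in> ell2 S" "ell2_norm S f = 0"
  shows "f = (\<lambda>k. 0)"
  using norm_le_ell2_norm[OF assms(1)] assms(2) by auto

section \<open>Inner product and orthogonality\<close>

text \<open>The convergence is absolute, by comparison with the two sums of squares.\<close>

lemma ell2_inner_summable:
  assumes "f \<in> ell2 S" "g \<in> ell2 S"
  shows "(\<lambda>k. f k * cnj (g k)) summable_on S"
proof (rule Infinite_Sum.abs_summable_summable, rule Infinite_Sum.abs_summable_on_comparison_test')
  show "(\<lambda>k. (cmod (f k))\<^sup>2 + (cmod (g k))\<^sup>2) summable_on S"
    using assms by (auto simp: ell2_def intro: summable_on_add)
  show "cmod (f k * cnj (g k)) \<le> (cmod (f k))\<^sup>2 + (cmod (g k))\<^sup>2" for k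
  proof -
    have "2 * (cmod (f k) * cmod (g k)) \<le> (cmod (f k))\<^sup>2 + (cmod (g k))\<^sup>2"
      using sum_squares_bound[of "cmod (f k)" "cmod (g k)"] by (simp add: mult.assoc)
    moreover have "0 \<le> cmod (f k) * cmod (g k)" by simp
    ultimately show ?thesis unfolding norm_mult complex_mod_cnj by linarith
  qed
qed

lemma ell2_inner_add_left:
  assumes "f \<in> ell2 S" "g \<in> ell2 S" "v \<in> ell2 S"
  shows "ell2_inner S (\<lambda>k. f k + g k) v = ell2_inner S f v + ell2_inner S g v"
  unfolding ell2_inner_def distrib_right
  by (intro infsum_add ell2_inner_summable assms)

lemma ell2_inner_scale_left: "ell2_inner S (\<lambda>k. c * f k) v = c * ell2_inner S f v"
  unfolding ell2_inner_def by (subst infsum_cmult_right'[symmetric]) (simp add: algebra_simps)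

lemma ell2_inner_commute: "ell2_inner S f g = cnj (ell2_inner S g f)"
  unfolding ell2_inner_def by (subst infsum_cnj[symmetric]) (simp add: mult.commute)

lemma ell2_inner_add_right:
  assumes "f \<in> ell2 S" "g \<in> ell2 S" "v \<in> ell2 S"
  shows "ell2_inner S v (\<lambda>k. f k + g k) = ell2_inner S v f + ell2_inner S v g"
  using assms by (simp add: ell2_inner_commute[of S v] ell2_inner_add_left)

lemma ell2_inner_scale_right: "ell2_inner S v (\<lambda>k. c * f k) = cnj c * ell2_inner S v f"
  by (simp add: ell2_inner_commute[of S v] ell2_inner_scale_left)

lemma ell2_inner_diff_left:
  assumes "f \<in> ell2 S" "g \<in> ell2 S" "v \<in> ell2 S"
  shows "ell2_inner S (\<lambda>k. f k - g k) v = ell2_inner S f v - ell2_inner S g v"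
  using ell2_inner_add_left[of f S "\<lambda>k. (-1) * g k" v] ell2_inner_scale_left[of S "-1" g v] assms
  by simp

lemma ell2_norm_add_power2:
  assumes f: "f \<in> ell2 S" and g: "g \<in> ell2 S"
  shows "(ell2_norm S (\<lambda>k. f k + g k))\<^sup>2
    = (ell2_norm S f)\<^sup>2 + 2 * Re (ell2_inner S g f) + (ell2_norm S g)\<^sup>2"
proof -
  have "ell2_inner S (\<lambda>k. f k + g k) (\<lambda>k. f k + g k)
      = ell2_inner S f f + ell2_inner S f g + (ell2_inner S g f + ell2_inner S g g)"
    using f g by (simp add: ell2_inner_add_left ell2_inner_add_right)
  moreover have "Re (ell2_inner S f g) = Re (ell2_inner S g f)"
    by (subst ell2_inner_commute) simp
  ultimately have "Re (ell2_inner S (\<lambda>k. f k + g k) (\<lambda>k. f k + g k))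
    = (ell2_norm S f)\<^sup>2 + 2 * Re (ell2_inner S g f) + (ell2_norm S g)\<^sup>2"
    using ell2_inner_self[OF f] ell2_inner_self[OF g] by simp
  then show ?thesis
    using ell2_inner_self[OF ell2_add[OF f g]] by simp
qed

text \<open>Moving \<open>f\<close> by \<open>- t * cnj a\<close> times \<open>g\<close>, where
  \<open>a\<close> is the inner product of \<open>g\<close> and \<open>f\<close>, changes the
  squared norm by \<open>- 2 t |a|^2 + t^2 |a|^2 N\<close>. For small \<open>t\<close> this is
  negative unless \<open>a = 0\<close>.\<close>

lemma ell2_orthogonal_if_minimal:
  assumes f: "f \<in> ell2 S" and g: "g \<in> ell2 S"
    and min: "\<And>c. ell2_norm S f \<le> ell2_norm S (\<lambda>k. f k + c * g k)"
  shows "ell2_inner S g f = 0"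
proof -
  define a where "a = ell2_inner S g f"
  define N where "N = (ell2_norm S g)\<^sup>2"
  \<comment> \<open>This choice gives \<open>t * N \<le> 1\<close>, also when \<open>N = 0\<close>,
    so the quadratic term is at most half of the linear one.\<close>
  define t where "t = 1 / (N + 1)"
  have N: "N \<ge> 0" by (simp add: N_def)
  then have t: "t > 0" "t * N \<le> 1" by (auto simp: t_def field_simps)
  have "(ell2_norm S f)\<^sup>2 \<le> (ell2_norm S (\<lambda>k. f k + (- (of_real t * cnj a)) * g k))\<^sup>2"
    using min[of "- (of_real t * cnj a)"] f by (intro power_mono) auto
  also have "\<dots> = (ell2_norm S f)\<^sup>2 - 2 * (t * (cmod a)\<^sup>2) + (t * cmod a * ell2_norm S g)\<^sup>2"
  proof -
    have "ell2_inner S (\<lambda>k. (- (of_real t * cnj a)) * g k) f = - (of_real t * (a * cnj a))"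
      unfolding ell2_inner_scale_left a_def[symmetric] by simp
    also have "\<dots> = - complex_of_real (t * (cmod a)\<^sup>2)"
      by (simp add: complex_norm_square[symmetric])
    finally have "Re (ell2_inner S (\<lambda>k. (- (of_real t * cnj a)) * g k) f) = - (t * (cmod a)\<^sup>2)"
      by simp
    moreover have "cmod (- (of_real t * cnj a)) = t * cmod a"
      using t by (simp add: norm_mult)
    then have "ell2_norm S (\<lambda>k. (- (of_real t * cnj a)) * g k) = t * cmod a * ell2_norm S g"
      by (simp only: ell2_norm_scale)
    ultimately show ?thesis
      by (simp only: ell2_norm_add_power2[OF f ell2_scale[OF g]])
  qed
  finally have "2 * (t * (cmod a)\<^sup>2) \<le> t * (cmod a)\<^sup>2 * (t * N)"
    by (simp add: N_def power2_eq_square algebra_simps)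
  also have "\<dots> \<le> t * (cmod a)\<^sup>2 * 1"
    using t by (intro mult_left_mono) auto
  finally have "t * (cmod a)\<^sup>2 \<le> 0" by simp
  then have "(cmod a)\<^sup>2 \<le> 0" using t by (simp add: mult_le_0_iff)
  then show ?thesis by (simp add: a_def)
qed

section \<open>Limits and compactness\<close>

text \<open>Norms over finite sets pass to pointwise limits, and \<open>ell2_bounded\<close> does
  the rest. The hypothesis is only eventual because the least squares argument has its bound only
  for large indices.\<close>

lemma ell2_Fatou:
  assumes "\<forall>\<^sub>F n in sequentially. f n \<in> ell2 S \<and> ell2_norm S (f n) \<le> C"
    and lim: "\<And>k. (\<lambda>n. f n k) \<longlonglongrightarrow> g k"
  shows "g \<in> ell2 S" "ell2_norm S g \<le> C"
proof -
  have zero: "g k = 0" if "k \<notin> S" for k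
  proof -
    have "\<forall>\<^sub>F n in sequentially. f n k = 0"
      using assms(1) by eventually_elim (use that in \<open>auto simp: ell2_outside\<close>)
    then have "(\<lambda>n. f n k) \<longlonglongrightarrow> 0" by (rule tendsto_eventually)
    with lim[of k] show ?thesis by (rule LIMSEQ_unique)
  qed
  have bound: "L2_set (\<lambda>k. cmod (g k)) F \<le> C" if "finite F" "F \<subseteq> S" for F
  proof (rule tendsto_upperbound)
    show "(\<lambda>n. L2_set (\<lambda>k. cmod (f n k)) F) \<longlonglongrightarrow> L2_set (\<lambda>k. cmod (g k)) F"
      unfolding L2_set_def by (intro tendsto_intros lim)
    show "\<forall>\<^sub>F n in sequentially. L2_set (\<lambda>k. cmod (f n k)) F \<le> C"
      using assms(1) by eventually_elim (use L2_set_le_ell2_norm that in \<open>blast intro: order_trans\<close>)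
  qed simp
  show "g \<in> ell2 S" "ell2_norm S g \<le> C"
    using ell2_bounded[of S g C] zero bound by blast+
qed

lemma ell2_norm_tendsto:
  assumes f: "\<And>n. f n \<in> ell2 S" and g: "g \<in> ell2 S"
    and lim: "(\<lambda>n. ell2_norm S (\<lambda>k. f n k - g k)) \<longlonglongrightarrow> 0"
  shows "(\<lambda>n. ell2_norm S (f n)) \<longlonglongrightarrow> ell2_norm S g"
proof (rule Lim_transform2[where f = "\<lambda>n. ell2_norm S g"])
  have "\<bar>ell2_norm S g - ell2_norm S (f n)\<bar> \<le> ell2_norm S (\<lambda>k. f n k - g k)" for n
    using ell2_norm_triangle[of g S "\<lambda>k. f n k - g k"]
      ell2_norm_triangle_diff[of "f n" S "\<lambda>k. f n k - g k"] f g by simp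
  then show "(\<lambda>n. ell2_norm S g - ell2_norm S (f n)) \<longlonglongrightarrow> 0"
    by (intro Lim_null_comparison[OF _ lim]) auto
qed simp

lemma ell2_tendsto_pointwise:
  assumes f: "\<And>n. f n \<in> ell2 S" and g: "g \<in> ell2 S"
    and lim: "(\<lambda>n. ell2_norm S (\<lambda>k. f n k - g k)) \<longlonglongrightarrow> 0"
  shows "(\<lambda>n. f n k) \<longlonglongrightarrow> g k"
proof -
  have "(\<lambda>n. f n k - g k) \<longlonglongrightarrow> 0"
    by (rule Lim_null_comparison[OF _ lim]) (use f g norm_le_ell2_norm[of "\<lambda>k. f _ k - g k"] in auto)
  then show ?thesis by (simp add: LIM_zero_iff)
qed

text \<open>A diagonal subsequence converges pointwise. On a finite sublevel set of
  \<open>|V|\<close> this is norm convergence; off that set the bound on \<open>V * f n\<close>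
  makes the remainder uniformly small.\<close>

lemma ell2_compactness:
  fixes V :: "'a \<Rightarrow> real"
  assumes fin: "\<And>M. finite {k\<in>S. \<bar>V k\<bar> \<le> M}"
    and f: "\<And>n. f n \<in> ell2 S" "\<And>n. ell2_norm S (f n) \<le> C"
    and Vf: "\<And>n. (\<lambda>k. complex_of_real (V k) * f n k) \<in> ell2 S"
      "\<And>n. ell2_norm S (\<lambda>k. complex_of_real (V k) * f n k) \<le> C"
  obtains r g where "strict_mono (r :: nat \<Rightarrow> nat)" "g \<in> ell2 S"
    "(\<lambda>n. ell2_norm S (\<lambda>k. f (r n) k - g k)) \<longlonglongrightarrow> 0"
proof -
  \<comment> \<open>The finite sublevel sets exhaust \<open>S\<close>, so \<open>S\<close> is
    countable, as the diagonal argument requires.\<close>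
  have "S = (\<Union>n::nat. {k\<in>S. \<bar>V k\<bar> \<le> real n})"
    using real_arch_simple by blast
  also have "countable \<dots>"
    by (rule countable_UN) (auto intro: countable_finite fin)
  finally have "countable S" .
  moreover have "cmod (f n k) \<le> C" for n k
    using norm_le_ell2_norm[OF f(1)[of n], of k] f(2)[of n] by linarith
  ultimately obtain r where r: "strict_mono r"
    and conv: "\<And>k. k \<in> S \<Longrightarrow> \<exists>l. (\<lambda>n. f (r n) k) \<longlonglongrightarrow> l"
    using function_convergent_subsequence[of S f C] by blast
  define g where "g k = lim (\<lambda>n. f (r n) k)" for k
  have lim: "(\<lambda>n. f (r n) k) \<longlonglongrightarrow> g k" for k
  proof (cases "k \<in> S")
    case True
    then obtain l where "(\<lambda>n. f (r n) k) \<longlonglongrightarrow> l" using conv by blast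
    then show ?thesis using limI by (fastforce simp: g_def)
  next
    case False
    then have "f (r n) k = 0" for n by (rule ell2_outside[OF f(1)])
    then show ?thesis by (simp add: g_def)
  qed
  have g: "g \<in> ell2 S"
    by (rule ell2_Fatou(1)[OF _ lim, where S = S and C = C]) (use f in auto)
  \<comment> \<open>The limit inherits the weighted bound, hence the differences \<open>d n\<close>
    have weighted norm at most \<open>2 * C\<close>.\<close>
  have Vg: "(\<lambda>k. complex_of_real (V k) * g k) \<in> ell2 S"
    "ell2_norm S (\<lambda>k. complex_of_real (V k) * g k) \<le> C"
    using ell2_Fatou[where f = "\<lambda>n k. complex_of_real (V k) * f (r n) k" and S = S and C = C
        and g = "\<lambda>k. complex_of_real (V k) * g k"] Vf tendsto_mult_left[OF lim]
    by simp_all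
  define d where "d n k = f (r n) k - g k" for n k
  have d: "d n \<in> ell2 S" for n unfolding d_def using f g by simp
  have Vd: "(\<lambda>k. complex_of_real (V k) * d n k) \<in> ell2 S"
    "ell2_norm S (\<lambda>k. complex_of_real (V k) * d n k) \<le> 2 * C" for n
    using ell2_norm_triangle_diff[OF Vf(1)[of "r n"] Vg(1)] Vf[of "r n"] Vg
    by (auto simp: d_def algebra_simps)
  have C: "C \<ge> 0" using ell2_norm_nonneg[OF f(1)[of 0]] f(2)[of 0] by linarith
  have "(\<lambda>n. ell2_norm S (d n)) \<longlonglongrightarrow> 0"
  proof (rule LIMSEQ_I)
    fix e :: real assume e: "e > 0"
    \<comment> \<open>The part off the sublevel set will be bounded by \<open>2 * C / M\<close>, and
      \<open>M \<ge> 4 * C / e\<close> makes this at most \<open>e / 2\<close>. The summand 1 keeps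
      \<open>M\<close> positive when \<open>C = 0\<close>.\<close>
    define M where "M = 4 * C / e + 1"
    have M: "M > 0" "2 * C / M \<le> e / 2"
      using C e unfolding M_def by (auto simp: field_simps add_pos_nonneg)
    define F where "F = {k\<in>S. \<bar>V k\<bar> \<le> M}"
    have F: "finite F" "F \<subseteq> S" using fin by (auto simp: F_def)
    have "(\<lambda>n. L2_set (\<lambda>k. cmod (f (r n) k - g k)) F) \<longlonglongrightarrow> L2_set (\<lambda>k. cmod (g k - g k)) F"
      unfolding L2_set_def by (intro tendsto_intros lim)
    then have "(\<lambda>n. L2_set (\<lambda>k. cmod (d n k)) F) \<longlonglongrightarrow> 0"
      by (simp add: d_def L2_set_0')
    \<comment> \<open>With \<open>e / 3\<close> here the total is \<open>e / 3 + e / 2\<close>,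
      strictly below \<open>e\<close>, although \<open>ell2_bounded\<close> gives only a weak
      inequality.\<close>
    then obtain N where N: "\<And>n. n \<ge> N \<Longrightarrow> L2_set (\<lambda>k. cmod (d n k)) F < e / 3"
      using e LIMSEQ_D[of _ 0 "e / 3"] by fastforce
    have "ell2_norm S (d n) < e" if "n \<ge> N" for n
    proof -
      have "ell2_norm S (d n) \<le> e / 3 + e / 2"
      proof (rule ell2_bounded(2))
        fix G assume G: "finite G" "G \<subseteq> S"
        have "L2_set (\<lambda>k. cmod (d n k)) G
          \<le> L2_set (\<lambda>k. (if k \<in> F then cmod (d n k) else 0) + (1 / M) * cmod (complex_of_real (V k) * d n k)) G"
        proof (intro L2_set_mono)
          fix k assume "k \<in> G"
          \<comment> \<open>Off \<open>F\<close> the potential exceeds \<open>M\<close> in absolute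
            value, so a factor \<open>\<bar>V k\<bar> / M\<close> only enlarges the term.\<close>
          have "cmod (d n k) \<le> (1 / M) * (\<bar>V k\<bar> * cmod (d n k))" if "k \<notin> F"
          proof -
            have "M * cmod (d n k) \<le> \<bar>V k\<bar> * cmod (d n k)"
              using that \<open>k \<in> G\<close> G by (intro mult_right_mono) (auto simp: F_def)
            with M show ?thesis by (simp add: field_simps)
          qed
          with M show "cmod (d n k)
            \<le> (if k \<in> F then cmod (d n k) else 0) + (1 / M) * cmod (complex_of_real (V k) * d n k)"
            by (auto simp: norm_mult)
        qed auto
        also have "\<dots> \<le> L2_set (\<lambda>k. if k \<in> F then cmod (d n k) else 0) G
          + L2_set (\<lambda>k. (1 / M) * cmod (complex_of_real (V k) * d n k)) G"
          by (rule L2_set_triangle_ineq)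
        also have "L2_set (\<lambda>k. if k \<in> F then cmod (d n k) else 0) G \<le> L2_set (\<lambda>k. cmod (d n k)) F"
        proof -
          have "(\<Sum>k\<in>G. (if k \<in> F then cmod (d n k) else 0)\<^sup>2) = (\<Sum>k\<in>G \<inter> F. (cmod (d n k))\<^sup>2)"
            using G by (subst sum.inter_restrict) (auto intro!: sum.cong)
          also have "\<dots> \<le> (\<Sum>k\<in>F. (cmod (d n k))\<^sup>2)"
            using F by (intro sum_mono2) auto
          finally show ?thesis by (simp add: L2_set_def)
        qed
        also have "\<dots> \<le> e / 3" using N[OF that] by simp
        also have "L2_set (\<lambda>k. (1 / M) * cmod (complex_of_real (V k) * d n k)) G
            = (1 / M) * L2_set (\<lambda>k. cmod (complex_of_real (V k) * d n k)) G"
          using M by (subst L2_set_right_distrib) auto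
        also have "\<dots> \<le> (1 / M) * (2 * C)"
          using M L2_set_le_ell2_norm[OF Vd(1)[of n] G] Vd(2)[of n] by (intro mult_left_mono) auto
        also have "\<dots> \<le> e / 2" using M by simp
        finally show "L2_set (\<lambda>k. cmod (d n k)) G \<le> e / 3 + e / 2" by simp
      qed (rule ell2_outside[OF d])
      with e show ?thesis by linarith
    qed
    then show "\<exists>N. \<forall>n\<ge>N. norm (ell2_norm S (d n) - 0) < e"
      using d by auto
  qed
  with r g show ?thesis using that[of r g] by (simp add: d_def[abs_def])
qed

section \<open>Finite sums, finite supports and point masses\<close>

lemma ell2_inner_sum_left:
  "(\<And>i. i \<in> I \<Longrightarrow> f i \<in> ell2 S) \<Longrightarrow> v \<in> ell2 S \<Longrightarrow>
    ell2_inner S (\<lambda>k. \<Sum>i\<in>I. f i k) v = (\<Sum>i\<in>I. ell2_inner S (f i) v)"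
  by (induction I rule: infinite_finite_induct)
    (auto simp: ell2_inner_add_left, simp_all add: ell2_inner_def)

lemma ell2_finite_support:
  assumes "finite F" "F \<subseteq> S" "\<And>k. k \<notin> F \<Longrightarrow> f k = 0"
  shows "f \<in> ell2 S"
proof -
  have "{k\<in>S. (cmod (f k))\<^sup>2 \<noteq> 0} \<subseteq> F" using assms(3) by auto
  then have "finite {k\<in>S. (cmod (f k))\<^sup>2 \<noteq> 0}" using assms(1) finite_subset by blast
  then show ?thesis
    using assms(2,3) by (auto simp: ell2_def intro: finite_nonzero_values_imp_summable_on)
qed

text \<open>Testing against point masses turns a weak identity into a pointwise one; this later
  identifies the adjoint.\<close>

lemma ell2_inner_delta:
  assumes "x \<in> S"
  shows "ell2_inner S (\<lambda>k. if k = x then 1 else 0) g = cnj (g x)"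
proof -
  have "ell2_inner S (\<lambda>k. if k = x then 1 else 0) g = (\<Sum>\<^sub>\<infinity>k\<in>{x}. cnj (g k))"
    unfolding ell2_inner_def by (rule infsum_cong_neutral) (use assms in auto)
  then show ?thesis by simp
qed

text \<open>Some finite set carries all but \<open>(e / 2)\<^sup>2\<close> of the sum of squares,
  since the infinite sum is the supremum of the finite ones. This gives the density of the operator
  domain.\<close>

lemma ell2_truncation:
  assumes f: "f \<in> ell2 S" and "e > 0"
  obtains F where "finite F" "F \<subseteq> S" "ell2_norm S (\<lambda>k. f k - (if k \<in> F then f k else 0)) < e"
proof -
  let ?q = "\<lambda>k. (cmod (f k))\<^sup>2"
  have q: "?q summable_on S" using f by (simp add: ell2_def)
  have "\<exists>F. finite F \<and> F \<subseteq> S \<and> sum ?q F > infsum ?q S - (e / 2)\<^sup>2"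
  proof (rule ccontr)
    assume "\<not> ?thesis"
    then have "infsum ?q S \<le> infsum ?q S - (e / 2)\<^sup>2"
      using q by (intro infsum_le_finite_sums) (auto simp: not_less)
    with \<open>e > 0\<close> show False by simp
  qed
  then obtain F where F: "finite F" "F \<subseteq> S" "sum ?q F > infsum ?q S - (e / 2)\<^sup>2"
    by blast
  have "ell2_norm S (\<lambda>k. f k - (if k \<in> F then f k else 0)) \<le> e / 2"
  proof (rule ell2_bounded(2))
    fix G assume G: "finite G" "G \<subseteq> S"
    have "(\<Sum>k\<in>G. (cmod (f k - (if k \<in> F then f k else 0)))\<^sup>2) = (\<Sum>k\<in>G - F. ?q k)"
      using G by (intro sum.mono_neutral_cong_right) auto
    also have "\<dots> + sum ?q F = sum ?q (G \<union> F)"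
      using G F by (subst sum.union_disjoint[symmetric]) auto
    also have "\<dots> \<le> infsum ?q S"
      using G F q by (intro finite_sum_le_infsum) auto
    finally show "L2_set (\<lambda>k. cmod (f k - (if k \<in> F then f k else 0))) G \<le> e / 2"
      using \<open>e > 0\<close> F(3) by (subst L2_set_le_iff) auto
  qed (use ell2_outside[OF f] in auto)
  with F \<open>e > 0\<close> show ?thesis by (intro that[of F]) auto
qed

section \<open>Translations of an invariant set\<close>

context
  fixes S :: "'a::ab_group_add set" and a :: 'a
  assumes invariant: "\<And>k. k + a \<in> S \<longleftrightarrow> k \<in> S"
begin

lemma bij_betw_translate: "bij_betw (\<lambda>k. k + a) S S"
  using invariant invariant[of "_ - a"] by (intro bij_betw_byWitness[where f' = "\<lambda>k. k - a"]) auto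

lemma ell2_translate: "f \<in> ell2 S \<Longrightarrow> (\<lambda>k. f (k + a)) \<in> ell2 S"
  using summable_on_reindex_bij_betw[OF bij_betw_translate, of "\<lambda>k. (cmod (f k))\<^sup>2"]
  by (auto simp: ell2_def invariant)

text \<open>A change of variables: the adjoint of a translation is the inverse translation. The
  symmetry of the Laplacian rests on it.\<close>

lemma ell2_inner_translate: "ell2_inner S (\<lambda>k. f (k + a)) g = ell2_inner S f (\<lambda>k. g (k - a))"
  unfolding ell2_inner_def
  using infsum_reindex_bij_betw[OF bij_betw_translate, of "\<lambda>k. f k * cnj (g (k - a))"] by simp

lemma ell2_norm_translate: "ell2_norm S (\<lambda>k. f (k + a)) = ell2_norm S f"
  unfolding ell2_norm_def by (subst ell2_inner_translate) simp

end

section \<open>Self-adjoint operators with compact graph embedding\<close>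

text \<open>Induction on \<open>F\<close>: the members of \<open>E\<close> vanishing at one point
  \<open>a\<close> are determined by the remaining points, and if \<open>E\<close> has further
  members, a single one of them completes a spanning set.\<close>

lemma finite_dimensional_if_determined:
  assumes "finite F"
    and comb: "\<And>u v c. u \<in> E \<Longrightarrow> v \<in> E \<Longrightarrow> (\<lambda>k. u k - c * v k) \<in> E"
    and zero: "\<And>u. u \<in> E \<Longrightarrow> \<forall>k\<in>F. u k = 0 \<Longrightarrow> u = (\<lambda>k. 0)"
  shows "finite_dimensional E"
  using assms
proof (induction F arbitrary: E rule: finite_induct)
  case empty
  then have "\<forall>u\<in>E. \<exists>c. u = (\<lambda>k. \<Sum>b\<in>{}. c b * b k)" by auto
  then show ?case unfolding finite_dimensional_def by (intro exI[of _ "{}"]) simp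
next
  case (insert a F)
  define E' where "E' = {u\<in>E. u a = 0}"
  have "finite_dimensional E'"
    by (rule insert.IH) (use insert.prems in \<open>auto simp: E'_def\<close>)
  then obtain B where B: "finite B" "B \<subseteq> E'"
    and span: "\<And>u. u \<in> E' \<Longrightarrow> \<exists>c. u = (\<lambda>k. \<Sum>b\<in>B. c b * b k)"
    unfolding finite_dimensional_def by blast
  show ?case
  proof (cases "E = E'")
    case True
    with B span show ?thesis unfolding finite_dimensional_def by blast
  next
    case False
    then obtain v where v: "v \<in> E" "v a \<noteq> 0" by (auto simp: E'_def)
    have "\<exists>c. u = (\<lambda>k. \<Sum>b\<in>insert v B. c b * b k)" if "u \<in> E" for u
    proof -
      \<comment> \<open>Subtracting the multiple of \<open>v\<close> with the same value at
        \<open>a\<close> leads into \<open>E'\<close>, where the induction hypothesis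
        applies.\<close>
      have "(\<lambda>k. u k - (u a / v a) * v k) \<in> E'"
        using insert.prems(1)[OF that v(1), of "u a / v a"] v(2) by (simp add: E'_def)
      then obtain c where c: "(\<lambda>k. u k - (u a / v a) * v k) = (\<lambda>k. \<Sum>b\<in>B. c b * b k)"
        using span by blast
      have "v \<notin> B" using B v by (auto simp: E'_def)
      have "u k = (\<Sum>b\<in>insert v B. (c(v := u a / v a)) b * b k)" for k
      proof -
        have "(\<Sum>b\<in>insert v B. (c(v := u a / v a)) b * b k)
            = (u a / v a) * v k + (\<Sum>b\<in>B. c b * b k)"
          using B \<open>v \<notin> B\<close> by (auto intro!: sum.cong)
        also have "(\<Sum>b\<in>B. c b * b k) = u k - (u a / v a) * v k"
          using fun_cong[OF c, of k] by (simp only:)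
        finally show ?thesis by simp
      qed
      then show ?thesis by blast
    qed
    with B v show ?thesis
      unfolding finite_dimensional_def by (intro exI[of _ "insert v B"]) (auto simp: E'_def)
  qed
qed

text \<open>\<open>compact\<close> states that bounded sets in the graph norm are relatively compact
  in norm. For the images under \<open>A\<close> it asks only for pointwise convergence, which
  suffices to pass an eigenvalue equation to the limit. Countability of \<open>S\<close> provides an
  exhaustion by finite sets.\<close>

locale compact_self_adjoint =
  fixes S :: "'a set" and D :: "('a \<Rightarrow> complex) set" and A :: "('a \<Rightarrow> complex) \<Rightarrow> 'a \<Rightarrow> complex"
  assumes self_adjoint: "self_adjoint S D A"
    and countable: "countable S"
    and compact: "\<And>f C. (\<And>n. f n \<in> D) \<Longrightarrow> (\<And>n. ell2_norm S (f n) \<le> C) \<Longrightarrow>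
      (\<And>n. ell2_norm S (A (f n)) \<le> C) \<Longrightarrow>
      \<exists>(r :: nat \<Rightarrow> nat) g. strict_mono r \<and> g \<in> D \<and>
        (\<lambda>n. ell2_norm S (\<lambda>k. f (r n) k - g k)) \<longlonglongrightarrow> 0 \<and>
        (\<forall>k. (\<lambda>n. A (f (r n)) k) \<longlonglongrightarrow> A g k)"
begin

section \<open>Algebraic consequences of self-adjointness\<close>

text \<open>The form in which self-adjointness is used: a weak identity tested on \<open>D\<close>
  suffices to conclude that \<open>v\<close> lies in the domain and to compute its image.\<close>

lemma adjoint_graph_iff: "(v, w) \<in> adjoint_graph S D A \<longleftrightarrow> v \<in> D \<and> w = A v"
  using self_adjoint by (auto simp: self_adjoint_def)

lemma mem_ell2: "u \<in> D \<Longrightarrow> u \<in> ell2 S" and A_mem_ell2: "u \<in> D \<Longrightarrow> A u \<in> ell2 S"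
  using adjoint_graph_iff[of u "A u"] by (auto simp: adjoint_graph_def)

lemma symmetric: "u \<in> D \<Longrightarrow> v \<in> D \<Longrightarrow> ell2_inner S (A u) v = ell2_inner S u (A v)"
  using adjoint_graph_iff[of v "A v"] by (auto simp: adjoint_graph_def)

text \<open>By symmetry the combined pair satisfies the weak identity defining the adjoint, so it
  lies in the graph of \<open>A\<close>.\<close>

lemma linear:
  assumes "u \<in> D" "v \<in> D"
  shows "(\<lambda>k. u k + c * v k) \<in> D" "A (\<lambda>k. u k + c * v k) = (\<lambda>k. A u k + c * A v k)"
proof -
  have "((\<lambda>k. u k + c * v k), (\<lambda>k. A u k + c * A v k)) \<in> adjoint_graph S D A"
    using assms mem_ell2 A_mem_ell2 symmetric
    by (simp add: adjoint_graph_def ell2_inner_add_right ell2_inner_scale_right)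
  then show "(\<lambda>k. u k + c * v k) \<in> D" "A (\<lambda>k. u k + c * v k) = (\<lambda>k. A u k + c * A v k)"
    by (simp_all add: adjoint_graph_iff)
qed

lemma zero: "(\<lambda>k. 0) \<in> D" "A (\<lambda>k. 0) = (\<lambda>k. 0)"
proof -
  have "((\<lambda>k. 0), (\<lambda>k. 0)) \<in> adjoint_graph S D A"
    by (simp add: adjoint_graph_def ell2_inner_def)
  then show "(\<lambda>k. 0) \<in> D" "A (\<lambda>k. 0) = (\<lambda>k. 0)"
    by (simp_all add: adjoint_graph_iff)
qed

lemma scale:
  assumes "v \<in> D"
  shows "(\<lambda>k. c * v k) \<in> D" "A (\<lambda>k. c * v k) = (\<lambda>k. c * A v k)"
  using linear[OF zero(1) assms, of c] by (simp_all add: zero(2))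

lemma shift_mem_ell2: "u \<in> D \<Longrightarrow> (\<lambda>k. A u k - z * u k) \<in> ell2 S"
  by (simp add: mem_ell2 A_mem_ell2)

text \<open>Converts control of \<open>A - z\<close> into the control of \<open>A\<close> that
  \<open>compact\<close> demands.\<close>

lemma norm_A_le:
  assumes "u \<in> D"
  shows "ell2_norm S (A u) \<le> ell2_norm S (\<lambda>k. A u k - z * u k) + cmod z * ell2_norm S u"
  using ell2_norm_triangle[OF shift_mem_ell2[OF assms, of z] ell2_scale[OF mem_ell2[OF assms], of z]]
  by simp

lemma eigenspace_mem: "u \<in> op_eigenspace D A z \<Longrightarrow> u \<in> D"
  by (simp add: op_eigenspace_def)

lemma eigenvalue_real:
  assumes "u \<in> op_eigenspace D A z" "u \<noteq> (\<lambda>k. 0)"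
  shows "cnj z = z"
proof -
  have u: "u \<in> D" "A u = (\<lambda>k. z * u k)" using assms by (auto simp: op_eigenspace_def)
  have "z * ell2_inner S u u = cnj z * ell2_inner S u u"
    using symmetric[OF u(1) u(1)] by (simp add: u(2) ell2_inner_scale_left ell2_inner_scale_right)
  moreover have "ell2_inner S u u \<noteq> 0"
    using ell2_inner_self ell2_norm_eq_0 mem_ell2[OF u(1)] assms(2) by fastforce
  ultimately show ?thesis by simp
qed

lemma normalize:
  assumes "u \<in> D" "u \<noteq> (\<lambda>k. 0)"
  obtains c where "c \<noteq> 0" "(\<lambda>k. c * u k) \<in> D" "ell2_norm S (\<lambda>k. c * u k) = 1"
    "cmod c * ell2_norm S u = 1" "A (\<lambda>k. c * u k) = (\<lambda>k. c * A u k)"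
proof -
  have "ell2_norm S u > 0"
    using assms ell2_norm_eq_0[OF mem_ell2] ell2_norm_nonneg[OF mem_ell2] less_eq_real_def by metis
  moreover define c where "c = complex_of_real (1 / ell2_norm S u)"
  ultimately have "c \<noteq> 0" "cmod c * ell2_norm S u = 1" by (auto simp: norm_divide)
  then show ?thesis
    using scale[OF assms(1), of c] by (intro that[of c]) auto
qed

section \<open>Compactness arguments for the resolvent\<close>

text \<open>The common core of the lower bound, the isolation of eigenvalues and the finite
  multiplicity. The sequence is bounded in the graph norm; the limit of a subsequence satisfies the
  eigenvalue equation pointwise, and norm convergence keeps its norm equal to 1.\<close>

lemma approximate_eigenvectors_converge:
  assumes f: "\<And>n. f n \<in> D" "\<And>n. ell2_norm S (f n) = 1"
    and z: "z \<longlonglongrightarrow> z0"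
    and res: "(\<lambda>n. ell2_norm S (\<lambda>k. A (f n) k - z n * f n k)) \<longlonglongrightarrow> 0"
  obtains r g where "strict_mono (r :: nat \<Rightarrow> nat)" "g \<in> op_eigenspace D A z0" "ell2_norm S g = 1"
    "(\<lambda>n. ell2_norm S (\<lambda>k. f (r n) k - g k)) \<longlonglongrightarrow> 0"
proof -
  have "Bseq (\<lambda>n. ell2_norm S (\<lambda>k. A (f n) k - z n * f n k) + cmod (z n))"
    by (rule convergent_imp_Bseq[OF convergentI[OF tendsto_add[OF res tendsto_norm[OF z]]]])
  then obtain K where K: "\<And>n. ell2_norm S (\<lambda>k. A (f n) k - z n * f n k) + cmod (z n) \<le> K"
    unfolding Bseq_def real_norm_def using abs_le_D1 by blast
  have "ell2_norm S (A (f n)) \<le> max 1 K" for n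
    using norm_A_le[OF f(1)[of n], of "z n"] f(2)[of n] K[of n] by simp
  then obtain r :: "nat \<Rightarrow> nat" and g where r: "strict_mono r" and g: "g \<in> D"
    and lim: "(\<lambda>n. ell2_norm S (\<lambda>k. f (r n) k - g k)) \<longlonglongrightarrow> 0"
    and A_lim: "\<And>k. (\<lambda>n. A (f (r n)) k) \<longlonglongrightarrow> A g k"
    using compact[of f "max 1 K"] f by auto
  have "A g k = z0 * g k" for k
  proof -
    have "(\<lambda>n. A (f (r n)) k - z (r n) * f (r n) k) \<longlonglongrightarrow> A g k - z0 * g k"
      using ell2_tendsto_pointwise[OF mem_ell2[OF f(1)] mem_ell2[OF g] lim]
        LIMSEQ_subseq_LIMSEQ[OF z r]
      by (intro tendsto_intros A_lim) (auto simp: o_def)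
    moreover have "(\<lambda>n. A (f (r n)) k - z (r n) * f (r n) k) \<longlonglongrightarrow> 0"
    proof (rule Lim_null_comparison)
      show "(\<lambda>n. ell2_norm S (\<lambda>k. A (f (r n)) k - z (r n) * f (r n) k)) \<longlonglongrightarrow> 0"
        using LIMSEQ_subseq_LIMSEQ[OF res r] by (simp add: o_def)
      show "\<forall>\<^sub>F n in sequentially. cmod (A (f (r n)) k - z (r n) * f (r n) k)
          \<le> ell2_norm S (\<lambda>k. A (f (r n)) k - z (r n) * f (r n) k)"
        using norm_le_ell2_norm[OF shift_mem_ell2[OF f(1)]] by simp
    qed
    ultimately show ?thesis using LIMSEQ_unique by fastforce
  qed
  then have "g \<in> op_eigenspace D A z0" using g by (auto simp: op_eigenspace_def)
  moreover have "ell2_norm S g = 1"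
    using ell2_norm_tendsto[OF mem_ell2[OF f(1)] mem_ell2[OF g] lim] f(2)
    by (simp add: LIMSEQ_const_iff)
  ultimately show ?thesis using that r lim by blast
qed

text \<open>If every constant failed, rescaled counterexamples would be unit vectors with residuals
  tending to 0, and their limit would be a unit eigenvector.\<close>

lemma bounded_below:
  assumes "op_eigenspace D A z \<subseteq> {\<lambda>k. 0}"
  shows "\<exists>C>0. \<forall>u\<in>D. ell2_norm S u \<le> C * ell2_norm S (\<lambda>k. A u k - z * u k)"
proof (rule ccontr)
  assume neg: "\<not> ?thesis"
  \<comment> \<open>The negated claim concerns positive constants only, hence
    \<open>Suc n\<close>.\<close>
  have "\<exists>u\<in>D. ell2_norm S u > real (Suc n) * ell2_norm S (\<lambda>k. A u k - z * u k)" for n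
    using neg by (metis not_le of_nat_0_less_iff zero_less_Suc)
  then obtain u where u: "\<And>n. u n \<in> D"
    "\<And>n. ell2_norm S (u n) > real (Suc n) * ell2_norm S (\<lambda>k. A (u n) k - z * u n k)"
    by metis
  have "\<exists>v\<in>D. ell2_norm S v = 1 \<and> ell2_norm S (\<lambda>k. A v k - z * v k) \<le> inverse (real (Suc n))" for n
  proof -
    \<comment> \<open>The inequality for \<open>u n\<close> is strict, and for the zero function
      both of its sides would be 0.\<close>
    have "u n \<noteq> (\<lambda>k. 0)"
    proof
      assume "u n = (\<lambda>k. 0)"
      with u(2)[of n] show False by (simp add: zero)
    qed
    with u(1) obtain c where c: "c \<noteq> 0" "(\<lambda>k. c * u n k) \<in> D" "ell2_norm S (\<lambda>k. c * u n k) = 1"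
      "cmod c * ell2_norm S (u n) = 1" "A (\<lambda>k. c * u n k) = (\<lambda>k. c * A (u n) k)"
      using normalize[of "u n"] by metis
    have "(\<lambda>k. A (\<lambda>k. c * u n k) k - z * (c * u n k)) = (\<lambda>k. c * (A (u n) k - z * u n k))"
      by (simp add: c(5) algebra_simps)
    then have "real (Suc n) * ell2_norm S (\<lambda>k. A (\<lambda>k. c * u n k) k - z * (c * u n k))
        = cmod c * (real (Suc n) * ell2_norm S (\<lambda>k. A (u n) k - z * u n k))"
      by simp
    also have "\<dots> \<le> cmod c * ell2_norm S (u n)"
      using u(2)[of n] by (intro mult_left_mono) auto
    finally have "ell2_norm S (\<lambda>k. A (\<lambda>k. c * u n k) k - z * (c * u n k)) \<le> inverse (real (Suc n))"
      by (simp add: c(4) field_simps)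
    with c show ?thesis by (intro bexI[of _ "\<lambda>k. c * u n k"]) auto
  qed
  then obtain v where v: "\<And>n. v n \<in> D" "\<And>n. ell2_norm S (v n) = 1"
    "\<And>n. ell2_norm S (\<lambda>k. A (v n) k - z * v n k) \<le> inverse (real (Suc n))"
    by metis
  have "(\<lambda>n. ell2_norm S (\<lambda>k. A (v n) k - z * v n k)) \<longlonglongrightarrow> 0"
    by (rule Lim_null_comparison[OF _ LIMSEQ_inverse_real_of_nat])
      (use v ell2_norm_nonneg[OF shift_mem_ell2[OF v(1)]] in auto)
  then obtain r g where "strict_mono (r :: nat \<Rightarrow> nat)" "g \<in> op_eigenspace D A z" "ell2_norm S g = 1"
    "(\<lambda>n. ell2_norm S (\<lambda>k. v (r n) k - g k)) \<longlonglongrightarrow> 0"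
    by (rule approximate_eigenvectors_converge[OF v(1,2) tendsto_const])
  with assms show False by auto
qed

text \<open>A minimising sequence for the residual is bounded in the graph norm by
  \<open>bounded_below\<close>, so a limit point attains the infimum. The minimal residual is
  orthogonal to the range of \<open>A - z\<close>, hence in the kernel of its adjoint, which the
  second assumption makes trivial.\<close>

lemma surjective:
  assumes "op_eigenspace D A z \<subseteq> {\<lambda>k. 0}" "op_eigenspace D A (cnj z) \<subseteq> {\<lambda>k. 0}"
    and f: "f \<in> ell2 S"
  shows "\<exists>u\<in>D. (\<lambda>k. A u k - z * u k) = f"
proof -
  define R where "R u = ell2_norm S (\<lambda>k. A u k - z * u k - f k)" for u
  define m where "m = Inf (R ` D)"
  have mem: "(\<lambda>k. A u k - z * u k - f k) \<in> ell2 S" if "u \<in> D" for u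
    using shift_mem_ell2[OF that] f by simp
  have R_nonneg: "R u \<ge> 0" if "u \<in> D" for u
    unfolding R_def using mem[OF that] by (rule ell2_norm_nonneg)
  have m_le: "m \<le> R u" if "u \<in> D" for u
    unfolding m_def using that R_nonneg by (intro cINF_lower bdd_belowI2) auto
  have "\<exists>u\<in>D. R u < m + inverse (real (Suc n))" for n
  proof -
    have "Inf (R ` D) < m + inverse (real (Suc n))" by (simp add: m_def)
    then obtain y where "y \<in> R ` D" "y < m + inverse (real (Suc n))"
      using cInf_lessD[of "R ` D"] zero(1) by blast
    then show ?thesis by blast
  qed
  then obtain u where u: "\<And>n. u n \<in> D" "\<And>n. R (u n) < m + inverse (real (Suc n))"
    by metis
  obtain C where C: "C > 0" "\<And>v. v \<in> D \<Longrightarrow> ell2_norm S v \<le> C * ell2_norm S (\<lambda>k. A v k - z * v k)"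
    using bounded_below[OF assms(1)] by blast
  \<comment> \<open>\<open>K\<close> bounds the images under \<open>A - z\<close>. Then
    \<open>C * K\<close> bounds \<open>u n\<close>, and \<open>K + cmod z * (C * K)\<close> bounds
    \<open>A (u n)\<close>; their maximum serves as the single bound in
    \<open>compact\<close>.\<close>
  define K where "K = m + 1 + ell2_norm S f"
  have Tu: "ell2_norm S (\<lambda>k. A (u n) k - z * u n k) \<le> K" for n
  proof -
    have "ell2_norm S (\<lambda>k. (A (u n) k - z * u n k - f k) + f k) \<le> R (u n) + ell2_norm S f"
      unfolding R_def by (rule ell2_norm_triangle[OF mem[OF u(1)] f])
    moreover have "inverse (real (Suc n)) \<le> 1" by (simp add: field_simps)
    ultimately show ?thesis using u(2)[of n] by (simp add: K_def)
  qed
  have u_norm: "ell2_norm S (u n) \<le> C * K" for n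
    using C(2)[OF u(1)[of n]] mult_left_mono[OF Tu[of n], of C] C(1) by linarith
  have "ell2_norm S (A (u n)) \<le> K + cmod z * (C * K)" for n
    using norm_A_le[OF u(1)[of n], of z] Tu[of n] mult_left_mono[OF u_norm[of n], of "cmod z"]
    by (simp add: mult.assoc)
  then have "ell2_norm S (A (u n)) \<le> max (C * K) (K + cmod z * (C * K))" for n
    using le_max_iff_disj by blast
  moreover have "ell2_norm S (u n) \<le> max (C * K) (K + cmod z * (C * K))" for n
    using u_norm le_max_iff_disj by blast
  ultimately obtain r :: "nat \<Rightarrow> nat" and v where r: "strict_mono r" and v: "v \<in> D"
    and lim: "(\<lambda>n. ell2_norm S (\<lambda>k. u (r n) k - v k)) \<longlonglongrightarrow> 0"
    and A_lim: "\<And>k. (\<lambda>n. A (u (r n)) k) \<longlonglongrightarrow> A v k"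
    using compact[of u "max (C * K) (K + cmod z * (C * K))"] u(1) by auto
  define w where "w k = A v k - z * v k - f k" for k
  have w: "w \<in> ell2 S" using mem[OF v] by (simp add: w_def[abs_def])
  have res_lim: "(\<lambda>n. A (u (r n)) k - z * u (r n) k - f k) \<longlonglongrightarrow> w k" for k
    unfolding w_def
    by (intro tendsto_intros A_lim ell2_tendsto_pointwise[OF mem_ell2[OF u(1)] mem_ell2[OF v] lim])
  \<comment> \<open>Lower semicontinuity: the residuals are known to converge only pointwise, so
    Fatou is applied with \<open>m + e\<close> for every positive \<open>e\<close>.\<close>
  have "ell2_norm S w \<le> m"
  proof (rule field_le_epsilon)
    fix e :: real assume "e > 0"
    then have "\<forall>\<^sub>F n in sequentially. inverse (real (Suc n)) < e"
      using order_tendstoD(2)[OF LIMSEQ_inverse_real_of_nat] by blast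
    then have "\<forall>\<^sub>F n in sequentially. inverse (real (Suc (r n))) < e"
      using filterlim_subseq[OF r] unfolding filterlim_iff by blast
    then have "\<forall>\<^sub>F n in sequentially. (\<lambda>k. A (u (r n)) k - z * u (r n) k - f k) \<in> ell2 S
        \<and> ell2_norm S (\<lambda>k. A (u (r n)) k - z * u (r n) k - f k) \<le> m + e"
    proof eventually_elim
      case (elim n)
      then show ?case using u(2)[of "r n"] mem[OF u(1)] by (simp add: R_def)
    qed
    then show "ell2_norm S w \<le> m + e" by (rule ell2_Fatou(2)[OF _ res_lim])
  qed
  have orth: "ell2_inner S (\<lambda>k. A y k - z * y k) w = 0" if y: "y \<in> D" for y
  proof (rule ell2_orthogonal_if_minimal[OF w shift_mem_ell2[OF y]])
    fix c
    \<comment> \<open>Perturbing \<open>v\<close> by \<open>c * y\<close> perturbs the residual by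
      \<open>c\<close> times the image of \<open>y\<close> under \<open>A - z\<close>, so minimality
      applies.\<close>
    have "ell2_norm S w \<le> R (\<lambda>k. v k + c * y k)"
      using \<open>ell2_norm S w \<le> m\<close> m_le[OF linear(1)[OF v y]] by (rule order_trans)
    also have "\<dots> = ell2_norm S (\<lambda>k. w k + c * (A y k - z * y k))"
      by (simp add: R_def linear(2)[OF v y] w_def algebra_simps)
    finally show "ell2_norm S w \<le> ell2_norm S (\<lambda>k. w k + c * (A y k - z * y k))" .
  qed
  \<comment> \<open>Orthogonality to the range is the eigenvalue equation for \<open>cnj z\<close>
    in weak form; self-adjointness then puts \<open>w\<close> into the domain.\<close>
  have "ell2_inner S (A y) w = ell2_inner S y (\<lambda>k. cnj z * w k)" if y: "y \<in> D" for y
    using orth[OF y] w ell2_inner_diff_left[OF A_mem_ell2[OF y] ell2_scale[OF mem_ell2[OF y], of z] w]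
    by (simp add: ell2_inner_scale_left ell2_inner_scale_right)
  then have "(w, \<lambda>k. cnj z * w k) \<in> adjoint_graph S D A"
    using w by (simp add: adjoint_graph_def)
  then have "w \<in> op_eigenspace D A (cnj z)"
    by (simp add: adjoint_graph_iff op_eigenspace_def)
  then have "w = (\<lambda>k. 0)" using assms(2) by blast
  then have "(\<lambda>k. A v k - z * v k) = f" by (simp add: w_def fun_eq_iff)
  with v show ?thesis by blast
qed

section \<open>Structure of the spectrum\<close>

lemma spectrum_eigenvalue:
  assumes "z \<in> op_spectrum S D A"
  shows "\<exists>u\<in>op_eigenspace D A z. u \<noteq> (\<lambda>k. 0)"
proof (rule ccontr)
  assume "\<not> ?thesis"
  then have triv: "op_eigenspace D A z \<subseteq> {\<lambda>k. 0}" by blast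
  \<comment> \<open>A nonzero eigenvector for \<open>cnj z\<close> would force \<open>z\<close> to
    be real, and so would also be one for \<open>z\<close>.\<close>
  have triv': "op_eigenspace D A (cnj z) \<subseteq> {\<lambda>k. 0}"
  proof
    fix u assume u: "u \<in> op_eigenspace D A (cnj z)"
    show "u \<in> {\<lambda>k. 0}"
    proof (rule ccontr)
      assume "u \<notin> {\<lambda>k. 0}"
      with eigenvalue_real[OF u] have "z = cnj z" by simp
      with u triv \<open>u \<notin> {\<lambda>k. 0}\<close> show False by auto
    qed
  qed
  have "bij_betw (\<lambda>u k. A u k - z * u k) D (ell2 S)"
    unfolding bij_betw_def
  proof
    show "inj_on (\<lambda>u k. A u k - z * u k) D"
    proof (rule inj_onI)
      fix u v assume uv: "u \<in> D" "v \<in> D" and eq: "(\<lambda>k. A u k - z * u k) = (\<lambda>k. A v k - z * v k)"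
      have "A u k - A v k = z * (u k - v k)" for k
        using fun_cong[OF eq, of k] by (simp add: algebra_simps)
      then have "(\<lambda>k. u k - v k) \<in> op_eigenspace D A z"
        using linear[OF uv, of "-1"] by (simp add: op_eigenspace_def)
      then have "(\<lambda>k. u k - v k) = (\<lambda>k. 0)" using triv by blast
      then show "u = v" by (simp add: fun_eq_iff)
    qed
    show "(\<lambda>u k. A u k - z * u k) ` D = ell2 S"
      using surjective[OF triv triv'] shift_mem_ell2 by (auto simp: image_iff)
  qed
  with bounded_below[OF triv] have "z \<in> resolvent_set S D A"
    unfolding resolvent_set_def by blast
  with assms show False by (simp add: op_spectrum_def)
qed

lemma normalized_eigenvector:
  assumes "u \<in> op_eigenspace D A z" "u \<noteq> (\<lambda>k. 0)"
  obtains c where "(\<lambda>k. c * u k) \<in> op_eigenspace D A z" "ell2_norm S (\<lambda>k. c * u k) = 1"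
proof -
  obtain c where "c \<noteq> 0" "(\<lambda>k. c * u k) \<in> D" "ell2_norm S (\<lambda>k. c * u k) = 1"
    "A (\<lambda>k. c * u k) = (\<lambda>k. c * A u k)"
    using normalize[OF eigenspace_mem[OF assms(1)] assms(2)] by metis
  with assms show ?thesis
    by (intro that[of c]) (auto simp: op_eigenspace_def algebra_simps)
qed

lemma eigenvectors_orthogonal:
  assumes u: "u \<in> op_eigenspace D A z" and v: "v \<in> op_eigenspace D A w" "v \<noteq> (\<lambda>k. 0)"
    and "z \<noteq> w"
  shows "ell2_inner S u v = 0"
proof -
  have "ell2_inner S (A u) v = ell2_inner S u (A v)"
    using u v by (intro symmetric eigenspace_mem)
  then have "z * ell2_inner S u v = cnj w * ell2_inner S u v"
    using u v by (simp add: op_eigenspace_def ell2_inner_scale_left ell2_inner_scale_right)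
  then show ?thesis using eigenvalue_real[OF v] \<open>z \<noteq> w\<close> by simp
qed

text \<open>At a limit point, unit eigenvectors for nearby eigenvalues would converge to a unit
  eigenvector for \<open>z\<close>. Eigenvectors for distinct eigenvalues are orthogonal, so the
  squared distance would stay equal to 2.\<close>

lemma spectrum_isolated:
  assumes z: "z \<in> op_spectrum S D A"
  shows "z isolated_in op_spectrum S D A"
proof (rule ccontr)
  assume "\<not> ?thesis"
  with z have "z islimpt op_spectrum S D A" by (simp add: isolated_in_islimpt_iff)
  then obtain w where w: "\<And>n. w n \<in> op_spectrum S D A - {z}" "w \<longlonglongrightarrow> z"
    unfolding islimpt_sequential by blast
  have "\<exists>v. v \<in> op_eigenspace D A (w n) \<and> ell2_norm S v = 1" for n
    using spectrum_eigenvalue[of "w n"] w(1)[of n] normalized_eigenvector by (metis DiffD1)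
  then obtain f where f: "\<And>n. f n \<in> op_eigenspace D A (w n)" "\<And>n. ell2_norm S (f n) = 1"
    by metis
  have res: "(\<lambda>n. ell2_norm S (\<lambda>k. A (f n) k - w n * f n k)) \<longlonglongrightarrow> 0"
    using f(1) by (simp add: op_eigenspace_def)
  obtain r g where "strict_mono (r :: nat \<Rightarrow> nat)"
    and g: "g \<in> op_eigenspace D A z" "ell2_norm S g = 1"
    and lim: "(\<lambda>n. ell2_norm S (\<lambda>k. f (r n) k - g k)) \<longlonglongrightarrow> 0"
    by (rule approximate_eigenvectors_converge[OF eigenspace_mem[OF f(1)] f(2) w(2) res])
  have "g \<noteq> (\<lambda>k. 0)" using g(2) by auto
  have "(ell2_norm S (\<lambda>k. f (r n) k - g k))\<^sup>2 = 2" for n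
  proof -
    have "ell2_inner S (f (r n)) g = 0"
      using eigenvectors_orthogonal[OF f(1) g(1) \<open>g \<noteq> (\<lambda>k. 0)\<close>] w(1)[of "r n"] by blast
    then have "ell2_inner S (\<lambda>k. - 1 * g k) (f (r n)) = 0"
      unfolding ell2_inner_scale_left by (subst ell2_inner_commute) simp
    moreover have "ell2_norm S (\<lambda>k. - 1 * g k) = 1"
      unfolding ell2_norm_scale using g(2) by simp
    ultimately have "(ell2_norm S (\<lambda>k. f (r n) k + - 1 * g k))\<^sup>2 = 2"
      using ell2_norm_add_power2[OF mem_ell2[OF eigenspace_mem[OF f(1)]]
          ell2_scale[OF mem_ell2[OF eigenspace_mem[OF g(1)]], of "- 1"], of "r n"]
      by (simp only: f(2)) simp
    then show ?thesis by simp
  qed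
  then have "(\<lambda>n. (2::real)) \<longlonglongrightarrow> 0\<^sup>2"
    using tendsto_power[OF lim, of 2] by simp
  then show False by (simp add: LIMSEQ_const_iff)
qed

text \<open>If no finite set of points determined the eigenvectors, there would be unit eigenvectors
  vanishing on ever larger finite sets, and a limit of norm 1 vanishing everywhere.\<close>

lemma eigenspace_finite_dimensional: "finite_dimensional (op_eigenspace D A z)"
proof -
  have "\<exists>F. finite F \<and> F \<subseteq> S \<and> (\<forall>u\<in>op_eigenspace D A z. (\<forall>k\<in>F. u k = 0) \<longrightarrow> u = (\<lambda>k. 0))"
  proof (rule ccontr)
    assume neg: "\<not> ?thesis"
    define F where "F n = {k\<in>S. to_nat_on S k \<le> n}" for n
    have F: "finite (F n)" "F n \<subseteq> S" for n
    proof -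
      have "inj_on (to_nat_on S) (F n)"
        using inj_on_to_nat_on[OF countable] by (rule inj_on_subset) (auto simp: F_def)
      then show "finite (F n)" by (rule inj_on_finite[where B = "{..n}"]) (auto simp: F_def)
    qed (auto simp: F_def)
    have "\<exists>v. v \<in> op_eigenspace D A z \<and> ell2_norm S v = 1 \<and> (\<forall>k\<in>F n. v k = 0)" for n
    proof -
      obtain u where u: "u \<in> op_eigenspace D A z" "\<forall>k\<in>F n. u k = 0" "u \<noteq> (\<lambda>k. 0)"
        using neg[unfolded not_ex, THEN spec, of "F n"] F[of n] by auto
      then show ?thesis using normalized_eigenvector[OF u(1,3)] by (metis mult_zero_right)
    qed
    then obtain f where f: "\<And>n. f n \<in> op_eigenspace D A z" "\<And>n. ell2_norm S (f n) = 1"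
      "\<And>n k. k \<in> F n \<Longrightarrow> f n k = 0"
      by metis
    have res: "(\<lambda>n. ell2_norm S (\<lambda>k. A (f n) k - z * f n k)) \<longlonglongrightarrow> 0"
      using f(1) by (simp add: op_eigenspace_def)
    obtain r g where r: "strict_mono (r :: nat \<Rightarrow> nat)" and g: "g \<in> op_eigenspace D A z" "ell2_norm S g = 1"
      and lim: "(\<lambda>n. ell2_norm S (\<lambda>k. f (r n) k - g k)) \<longlonglongrightarrow> 0"
      by (rule approximate_eigenvectors_converge[OF eigenspace_mem[OF f(1)] f(2) tendsto_const res])
    have "g k = 0" for k
    proof (cases "k \<in> S")
      case True
      have "\<forall>\<^sub>F n in sequentially. f (r n) k = 0"
      proof (rule eventually_sequentiallyI)
        fix n assume "to_nat_on S k \<le> n"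
        \<comment> \<open>A subsequence index satisfies \<open>n \<le> r n\<close>, and the sets
          \<open>F n\<close> increase.\<close>
        then have "k \<in> F (r n)"
          using True seq_suble[OF r, of n] by (auto simp: F_def)
        then show "f (r n) k = 0" by (rule f(3))
      qed
      then have "(\<lambda>n. f (r n) k) \<longlonglongrightarrow> 0" by (rule tendsto_eventually)
      moreover have "(\<lambda>n. f (r n) k) \<longlonglongrightarrow> g k"
        using ell2_tendsto_pointwise[OF mem_ell2[OF eigenspace_mem[OF f(1)]]
            mem_ell2[OF eigenspace_mem[OF g(1)]] lim] .
      ultimately show ?thesis using LIMSEQ_unique by blast
    next
      case False
      show ?thesis using ell2_outside[OF mem_ell2[OF eigenspace_mem[OF g(1)]] False] .
    qed
    then have "g = (\<lambda>k. 0)" by auto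
    with g(2) show False by simp
  qed
  then obtain F where F: "finite F" "\<And>u. u \<in> op_eigenspace D A z \<Longrightarrow> \<forall>k\<in>F. u k = 0 \<Longrightarrow> u = (\<lambda>k. 0)"
    by blast
  show ?thesis
  proof (rule finite_dimensional_if_determined[OF F(1) _ F(2)])
    fix u v c assume uv: "u \<in> op_eigenspace D A z" "v \<in> op_eigenspace D A z"
    then show "(\<lambda>k. u k - c * v k) \<in> op_eigenspace D A z"
      using linear[of u v "- c"] by (auto simp: op_eigenspace_def algebra_simps)
  qed
qed

lemma purely_discrete: "purely_discrete_spectrum S D A"
  using spectrum_isolated spectrum_eigenvalue eigenspace_finite_dimensional
  by (auto simp: purely_discrete_spectrum_def essential_spectrum_def discrete_spectrum_def)

end

section \<open>Lattice Schroedinger operators\<close>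

text \<open>Parametrising by integer tuples reduces countability and finiteness to facts about
  images.\<close>

lemma lattice_points_eq:
  "lattice_points h = range (\<lambda>m :: 'n \<Rightarrow> int. h *\<^sub>R (\<chi> j. real_of_int (m j)) :: real ^ 'n)"
proof (intro set_eqI iffI)
  fix k :: "real ^ 'n"
  assume "k \<in> lattice_points h"
  then obtain m :: "real ^ 'n" where m: "k = h *\<^sub>R m" "\<forall>j. m $ j \<in> \<int>"
    by (auto simp: lattice_points_def)
  then have "k = h *\<^sub>R (\<chi> j. real_of_int \<lfloor>m $ j\<rfloor>)"
    by (auto simp: vec_eq_iff)
  then show "k \<in> range (\<lambda>m. h *\<^sub>R (\<chi> j. real_of_int (m j)))"
    by (rule range_eqI[where x = "\<lambda>j. \<lfloor>m $ j\<rfloor>"])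
qed (auto simp: lattice_points_def)

lemma countable_lattice_points: "countable (lattice_points h :: (real ^ 'n) set)"
  unfolding lattice_points_eq by simp

lemma finite_lattice_points_cball:
  assumes "h > 0"
  shows "finite {k \<in> lattice_points h. norm (k :: real ^ 'n) \<le> b}"
proof (rule finite_subset)
  \<comment> \<open>Each coordinate satisfies \<open>h * |m j| \<le> norm k \<le> b\<close>, so a
    box of integers contains all admissible tuples.\<close>
  let ?Z = "{- \<lceil>b / h\<rceil>..\<lceil>b / h\<rceil>}"
  show "finite ((\<lambda>m. h *\<^sub>R (\<chi> j. real_of_int (m j)) :: real ^ 'n) ` (\<Pi>\<^sub>E j\<in>UNIV. ?Z))"
    by (intro finite_imageI finite_PiE) auto
  show "{k \<in> lattice_points h. norm (k :: real ^ 'n) \<le> b}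
      \<subseteq> (\<lambda>m. h *\<^sub>R (\<chi> j. real_of_int (m j))) ` (\<Pi>\<^sub>E j\<in>UNIV. ?Z)"
  proof
    fix k :: "real ^ 'n" assume "k \<in> {k \<in> lattice_points h. norm k \<le> b}"
    then have "norm k \<le> b" and "k \<in> lattice_points h" by auto
    then obtain m :: "'n \<Rightarrow> int" where m: "k = h *\<^sub>R (\<chi> j. real_of_int (m j))"
      unfolding lattice_points_eq by blast
    have "m j \<in> ?Z" for j
    proof -
      have "h * \<bar>real_of_int (m j)\<bar> = \<bar>k $ j\<bar>"
        using assms by (simp add: m abs_mult)
      also have "\<dots> \<le> b"
        using component_le_norm_cart[of k j] \<open>norm k \<le> b\<close> by linarith
      finally have "h * \<bar>real_of_int (m j)\<bar> \<le> b" .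
      then have "\<bar>real_of_int (m j)\<bar> \<le> b / h"
        using assms by (simp add: field_simps)
      then show ?thesis by (simp add: le_ceiling_iff abs_le_iff) linarith
    qed
    then show "k \<in> (\<lambda>m. h *\<^sub>R (\<chi> j. real_of_int (m j))) ` (\<Pi>\<^sub>E j\<in>UNIV. ?Z)"
      using m by auto
  qed
qed

lemma lattice_points_add_axis:
  fixes k :: "real ^ 'n"
  shows "k + h *\<^sub>R axis j 1 \<in> lattice_points h \<longleftrightarrow> k \<in> lattice_points h"
    and "k - h *\<^sub>R axis j 1 \<in> lattice_points h \<longleftrightarrow> k \<in> lattice_points h"
proof -
  \<comment> \<open>Allowing an integer \<open>c\<close> covers both shifts; each equivalence then
    uses \<open>c = 1\<close> and \<open>c = -1\<close>, one for each direction.\<close>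
  have *: "k + h *\<^sub>R (c *\<^sub>R axis j 1) \<in> lattice_points h"
    if "k \<in> lattice_points h" "c \<in> \<int>" for k :: "real ^ 'n" and c
  proof -
    obtain m :: "real ^ 'n" where "k = h *\<^sub>R m" "\<forall>i. m $ i \<in> \<int>"
      using \<open>k \<in> lattice_points h\<close> by (auto simp: lattice_points_def)
    then have "k + h *\<^sub>R (c *\<^sub>R axis j 1) = h *\<^sub>R (m + c *\<^sub>R axis j 1)"
      "\<forall>i. (m + c *\<^sub>R axis j 1) $ i \<in> \<int>"
      using \<open>c \<in> \<int>\<close> by (auto simp: algebra_simps axis_def)
    then show ?thesis unfolding lattice_points_def by blast
  qed
  show "k + h *\<^sub>R axis j 1 \<in> lattice_points h \<longleftrightarrow> k \<in> lattice_points h"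
    using *[of k 1] *[of "k + h *\<^sub>R axis j 1" "-1"] by auto
  show "k - h *\<^sub>R axis j 1 \<in> lattice_points h \<longleftrightarrow> k \<in> lattice_points h"
    using *[of k "-1"] *[of "k - h *\<^sub>R axis j 1" 1] by auto
qed

lemma ell2_lattice_translate:
  fixes u :: "real ^ 'n \<Rightarrow> complex"
  shows "u \<in> ell2 (lattice_points h) \<Longrightarrow> (\<lambda>k. u (k + h *\<^sub>R axis j 1)) \<in> ell2 (lattice_points h)"
    and "u \<in> ell2 (lattice_points h) \<Longrightarrow> (\<lambda>k. u (k - h *\<^sub>R axis j 1)) \<in> ell2 (lattice_points h)"
    and "ell2_norm (lattice_points h) (\<lambda>k. u (k + h *\<^sub>R axis j 1)) = ell2_norm (lattice_points h) u"
    and "ell2_norm (lattice_points h) (\<lambda>k. u (k - h *\<^sub>R axis j 1)) = ell2_norm (lattice_points h) u"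
    and "ell2_inner (lattice_points h) (\<lambda>k. u (k + h *\<^sub>R axis j 1)) v
      = ell2_inner (lattice_points h) u (\<lambda>k. v (k - h *\<^sub>R axis j 1))"
    and "ell2_inner (lattice_points h) (\<lambda>k. u (k - h *\<^sub>R axis j 1)) v
      = ell2_inner (lattice_points h) u (\<lambda>k. v (k + h *\<^sub>R axis j 1))"
  using ell2_translate[of "h *\<^sub>R axis j 1" "lattice_points h" u]
    ell2_translate[of "- (h *\<^sub>R axis j 1)" "lattice_points h" u]
    ell2_norm_translate[of "h *\<^sub>R axis j 1" "lattice_points h" u]
    ell2_norm_translate[of "- (h *\<^sub>R axis j 1)" "lattice_points h" u]
    ell2_inner_translate[of "h *\<^sub>R axis j 1" "lattice_points h" u v]
    ell2_inner_translate[of "- (h *\<^sub>R axis j 1)" "lattice_points h" u v]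
  by (simp_all add: lattice_points_add_axis)

section \<open>The discrete Laplacian as a bounded symmetric operator\<close>

context
  fixes h :: real and S :: "(real ^ 'n) set"
  defines "S \<equiv> lattice_points h"
begin

lemma discrete_laplacian_eq:
  "discrete_laplacian h u = (\<lambda>k :: real ^ 'n.
    (\<Sum>j\<in>UNIV. u (k + h *\<^sub>R axis j 1) + u (k - h *\<^sub>R axis j 1)) - 2 * of_nat CARD('n) * u k)"
  by (simp add: fun_eq_iff discrete_laplacian_def)

lemma discrete_laplacian_mem_ell2: "u \<in> ell2 S \<Longrightarrow> discrete_laplacian h u \<in> ell2 S"
  unfolding discrete_laplacian_eq S_def
  by (intro ell2_diff ell2_sum ell2_add ell2_scale ell2_lattice_translate)

text \<open>The \<open>2 n\<close> translates each have the norm of \<open>u\<close>, and the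
  diagonal term contributes another \<open>2 n\<close>.\<close>

lemma norm_discrete_laplacian_le:
  assumes "u \<in> ell2 S"
  shows "ell2_norm S (discrete_laplacian h u) \<le> 4 * real CARD('n) * ell2_norm S u"
proof -
  note mem = ell2_lattice_translate(1,2)[OF assms[unfolded S_def]]
  have "ell2_norm S (discrete_laplacian h u)
      \<le> ell2_norm S (\<lambda>k. \<Sum>j\<in>UNIV. u (k + h *\<^sub>R axis j 1) + u (k - h *\<^sub>R axis j 1))
        + ell2_norm S (\<lambda>k. 2 * of_nat CARD('n) * u k)"
    unfolding discrete_laplacian_eq S_def using assms[unfolded S_def] mem
    by (intro ell2_norm_triangle_diff ell2_sum ell2_add ell2_scale)
  also have "ell2_norm S (\<lambda>k. \<Sum>j\<in>UNIV. u (k + h *\<^sub>R axis j 1) + u (k - h *\<^sub>R axis j 1))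
      \<le> (\<Sum>j\<in>(UNIV :: 'n set). ell2_norm S (\<lambda>k. u (k + h *\<^sub>R axis j 1) + u (k - h *\<^sub>R axis j 1)))"
    unfolding S_def using mem by (intro ell2_norm_sum ell2_add)
  also have "\<dots> \<le> (\<Sum>j\<in>(UNIV :: 'n set). 2 * ell2_norm S u)"
  proof (rule sum_mono)
    fix j :: 'n
    show "ell2_norm S (\<lambda>k. u (k + h *\<^sub>R axis j 1) + u (k - h *\<^sub>R axis j 1)) \<le> 2 * ell2_norm S u"
      using ell2_norm_triangle[OF mem] unfolding S_def by (simp add: ell2_lattice_translate)
  qed
  finally show ?thesis unfolding ell2_norm_scale by (simp add: norm_mult algebra_simps)
qed

text \<open>The shifts along \<open>j\<close> in opposite directions are adjoint to each other, so
  their sum \<open>I\<close> is Hermitian; the diagonal coefficient is real.\<close>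

lemma discrete_laplacian_symmetric:
  assumes u: "u \<in> ell2 S" and v: "v \<in> ell2 S"
  shows "ell2_inner S (discrete_laplacian h u) v = ell2_inner S u (discrete_laplacian h v)"
proof -
  define I where "I u v = (\<Sum>j\<in>(UNIV :: 'n set). ell2_inner S (\<lambda>k. u (k + h *\<^sub>R axis j 1)) v
      + ell2_inner S (\<lambda>k. u (k - h *\<^sub>R axis j 1)) v)" for u v
  have eq: "ell2_inner S (discrete_laplacian h u) v = I u v - 2 * of_nat CARD('n) * ell2_inner S u v"
    if u: "u \<in> ell2 S" and v: "v \<in> ell2 S" for u v
  proof -
    note mem = ell2_lattice_translate(1,2)[OF u[unfolded S_def], folded S_def]
    show ?thesis
      unfolding discrete_laplacian_eq I_def using u v mem
      by (subst ell2_inner_diff_left)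
        (simp_all add: ell2_inner_scale_left ell2_inner_sum_left ell2_inner_add_left)
  qed
  have "ell2_inner S (\<lambda>k. u (k + h *\<^sub>R axis j 1)) v = cnj (ell2_inner S (\<lambda>k. v (k - h *\<^sub>R axis j 1)) u)"
    and "ell2_inner S (\<lambda>k. u (k - h *\<^sub>R axis j 1)) v = cnj (ell2_inner S (\<lambda>k. v (k + h *\<^sub>R axis j 1)) u)"
    for j
    unfolding S_def ell2_lattice_translate(5,6)[of _ u] by (rule ell2_inner_commute)+
  then have "I u v = cnj (I v u)"
    by (simp add: I_def add.commute)
  moreover have "ell2_inner S u (discrete_laplacian h v) = cnj (ell2_inner S (discrete_laplacian h v) u)"
    by (rule ell2_inner_commute)
  moreover have "ell2_inner S u v = cnj (ell2_inner S v u)"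
    by (rule ell2_inner_commute)
  ultimately show ?thesis using eq[OF u v] eq[OF v u] by simp
qed

lemma discrete_laplacian_tendsto:
  assumes "\<And>k. (\<lambda>n. f n k) \<longlonglongrightarrow> g k"
  shows "(\<lambda>n. discrete_laplacian h (f n) k) \<longlonglongrightarrow> discrete_laplacian h g k"
  unfolding discrete_laplacian_def by (intro tendsto_intros assms)

section \<open>The Schroedinger operator\<close>

context
  fixes V :: "real ^ 'n \<Rightarrow> real"
begin

lemma schroedinger_eq:
  "schroedinger h V u = (\<lambda>k. - complex_of_real (1 / h\<^sup>2) * discrete_laplacian h u k
    + complex_of_real (V k) * u k)"
  by (simp add: fun_eq_iff schroedinger_def)

lemma potential_eq:
  "(\<lambda>k. complex_of_real (V k) * u k)
    = (\<lambda>k. schroedinger h V u k + complex_of_real (1 / h\<^sup>2) * discrete_laplacian h u k)"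
  by (simp add: fun_eq_iff schroedinger_def)

lemma schroedinger_dom_iff:
  "u \<in> schroedinger_dom h V \<longleftrightarrow> u \<in> ell2 S \<and> schroedinger h V u \<in> ell2 S"
proof -
  have "schroedinger h V u \<in> ell2 S" if "u \<in> ell2 S" "(\<lambda>k. u k + schroedinger h V u k) \<in> ell2 S"
    using ell2_diff[OF that(2,1)] by simp
  then show ?thesis by (auto simp: schroedinger_dom_def S_def)
qed

text \<open>The Laplacian maps \<open>ell2 S\<close> into itself, so the domain is that of
  multiplication by \<open>V\<close>.\<close>

lemma schroedinger_dom_iff_potential:
  "u \<in> schroedinger_dom h V \<longleftrightarrow> u \<in> ell2 S \<and> (\<lambda>k. complex_of_real (V k) * u k) \<in> ell2 S"
proof (cases "u \<in> ell2 S")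
  case True
  have "schroedinger h V u \<in> ell2 S \<longleftrightarrow> (\<lambda>k. complex_of_real (V k) * u k) \<in> ell2 S"
  proof
    assume "schroedinger h V u \<in> ell2 S"
    then show "(\<lambda>k. complex_of_real (V k) * u k) \<in> ell2 S"
      unfolding potential_eq by (intro ell2_add ell2_scale discrete_laplacian_mem_ell2 True)
  next
    assume "(\<lambda>k. complex_of_real (V k) * u k) \<in> ell2 S"
    then show "schroedinger h V u \<in> ell2 S"
      unfolding schroedinger_eq by (intro ell2_add ell2_scale discrete_laplacian_mem_ell2 True)
  qed
  then show ?thesis by (simp add: schroedinger_dom_iff)
qed (simp add: schroedinger_dom_iff)

lemma schroedinger_dom_finite_support:
  assumes "finite F" "F \<subseteq> S" "\<And>k. k \<notin> F \<Longrightarrow> u k = 0"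
  shows "u \<in> schroedinger_dom h V"
  unfolding schroedinger_dom_iff_potential using assms by (auto intro!: ell2_finite_support[of F])

text \<open>Only the Laplacian is moved to \<open>v\<close>: for a general \<open>v\<close> in
  \<open>ell2 S\<close> the product with \<open>V\<close> may fail to be square-summable.\<close>

lemma ell2_inner_schroedinger:
  assumes u: "u \<in> schroedinger_dom h V" and v: "v \<in> ell2 S"
  shows "ell2_inner S (schroedinger h V u) v
    = - complex_of_real (1 / h\<^sup>2) * ell2_inner S u (discrete_laplacian h v)
      + ell2_inner S (\<lambda>k. complex_of_real (V k) * u k) v"
proof -
  have u': "u \<in> ell2 S" "(\<lambda>k. complex_of_real (V k) * u k) \<in> ell2 S"
    using u by (auto simp: schroedinger_dom_iff_potential)
  show ?thesis
    unfolding schroedinger_eq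
    by (subst ell2_inner_add_left[OF ell2_scale[OF discrete_laplacian_mem_ell2[OF u'(1)]] u'(2) v])
      (simp only: ell2_inner_scale_left discrete_laplacian_symmetric[OF u'(1) v])
qed

lemma schroedinger_symmetric:
  assumes u: "u \<in> schroedinger_dom h V" and v: "v \<in> schroedinger_dom h V"
  shows "ell2_inner S (schroedinger h V u) v = ell2_inner S u (schroedinger h V v)"
proof -
  have v': "v \<in> ell2 S" "(\<lambda>k. complex_of_real (V k) * v k) \<in> ell2 S" and u': "u \<in> ell2 S"
    using u v by (auto simp: schroedinger_dom_iff_potential)
  have "ell2_inner S (\<lambda>k. complex_of_real (V k) * u k) v = ell2_inner S u (\<lambda>k. complex_of_real (V k) * v k)"
    by (simp add: ell2_inner_def algebra_simps)
  then show ?thesis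
    unfolding ell2_inner_schroedinger[OF u v'(1)] schroedinger_eq[of v]
    by (subst ell2_inner_add_right[OF ell2_scale[OF discrete_laplacian_mem_ell2[OF v'(1)]] v'(2) u'])
      (simp only: ell2_inner_scale_right, simp)
qed

lemma schroedinger_outside: "u \<in> ell2 S \<Longrightarrow> k \<notin> S \<Longrightarrow> schroedinger h V u k = 0"
  using ell2_outside[OF discrete_laplacian_mem_ell2] ell2_outside[of u S]
  by (simp add: schroedinger_def)

text \<open>One inclusion is symmetry. For the other, testing with point masses gives
  \<open>w = schroedinger h V v\<close> pointwise, and since \<open>w\<close> is in
  \<open>ell2 S\<close>, the maximal domain contains \<open>v\<close>.\<close>

lemma schroedinger_self_adjoint: "self_adjoint S (schroedinger_dom h V) (schroedinger h V)"
  unfolding self_adjoint_def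
proof
  show "densely_defined S (schroedinger_dom h V)"
    unfolding densely_defined_def
  proof (intro conjI ballI allI impI)
    fix f and e :: real assume "f \<in> ell2 S" "e > 0"
    then obtain F where F: "finite F" "F \<subseteq> S"
      "ell2_norm S (\<lambda>k. f k - (if k \<in> F then f k else 0)) < e"
      by (rule ell2_truncation)
    moreover have "(\<lambda>k. if k \<in> F then f k else 0) \<in> schroedinger_dom h V"
      by (rule schroedinger_dom_finite_support[OF F(1,2)]) simp
    ultimately show "\<exists>u\<in>schroedinger_dom h V. ell2_norm S (\<lambda>k. f k - u k) < e"
      by (intro bexI[of _ "\<lambda>k. if k \<in> F then f k else 0"])
  qed (auto simp: schroedinger_dom_iff)
  show "adjoint_graph S (schroedinger_dom h V) (schroedinger h V)
      = {(u, schroedinger h V u) | u. u \<in> schroedinger_dom h V}" (is "?G = ?H")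
  proof
    show "?H \<subseteq> ?G"
      using schroedinger_symmetric by (auto simp: adjoint_graph_def schroedinger_dom_iff)
    show "?G \<subseteq> ?H"
    proof
      fix p assume "p \<in> ?G"
      then obtain v w where p: "p = (v, w)" and v: "v \<in> ell2 S" and w: "w \<in> ell2 S"
        and adj: "\<And>u. u \<in> schroedinger_dom h V \<Longrightarrow>
          ell2_inner S (schroedinger h V u) v = ell2_inner S u w"
        by (auto simp: adjoint_graph_def)
      have "w x = schroedinger h V v x" for x
      proof (cases "x \<in> S")
        case True
        define d :: "real ^ 'n \<Rightarrow> complex" where "d k = (if k = x then 1 else 0)" for k
        have inner_d: "ell2_inner S d g = cnj (g x)" for g
          using ell2_inner_delta[OF True] by (simp add: d_def[abs_def])
        have d: "d \<in> schroedinger_dom h V"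
          by (rule schroedinger_dom_finite_support[of "{x}"]) (use True in \<open>auto simp: d_def\<close>)
        \<comment> \<open>On a point mass the potential acts as the scalar
          \<open>V x\<close>.\<close>
        have "(\<lambda>k. complex_of_real (V k) * d k) = (\<lambda>k. complex_of_real (V x) * d k)"
          by (auto simp: d_def)
        then have "ell2_inner S (\<lambda>k. complex_of_real (V k) * d k) v = complex_of_real (V x) * cnj (v x)"
          by (simp add: ell2_inner_scale_left inner_d)
        then have "cnj (w x) = cnj (schroedinger h V v x)"
          using adj[OF d] by (simp add: ell2_inner_schroedinger[OF d v] inner_d schroedinger_def)
        then show ?thesis by simp
      next
        case False
        then show ?thesis using ell2_outside[OF w] schroedinger_outside[OF v] by simp
      qed
      then have "w = schroedinger h V v" by auto
      with v w show "p \<in> ?H" by (auto simp: p schroedinger_dom_iff)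
    qed
  qed
qed

text \<open>Turns a bound in the graph norm into the weighted bound required by
  \<open>ell2_compactness\<close>.\<close>

lemma norm_potential_le:
  assumes "u \<in> schroedinger_dom h V"
  shows "ell2_norm S (\<lambda>k. complex_of_real (V k) * u k)
    \<le> ell2_norm S (schroedinger h V u) + 4 * real CARD('n) / h\<^sup>2 * ell2_norm S u"
proof -
  have u: "u \<in> ell2 S" "schroedinger h V u \<in> ell2 S"
    using assms by (auto simp: schroedinger_dom_iff)
  have "ell2_norm S (\<lambda>k. complex_of_real (V k) * u k)
      \<le> ell2_norm S (schroedinger h V u)
        + ell2_norm S (\<lambda>k. complex_of_real (1 / h\<^sup>2) * discrete_laplacian h u k)"
    unfolding potential_eq by (intro ell2_norm_triangle u ell2_scale discrete_laplacian_mem_ell2)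
  also have "ell2_norm S (\<lambda>k. complex_of_real (1 / h\<^sup>2) * discrete_laplacian h u k)
      = 1 / h\<^sup>2 * ell2_norm S (discrete_laplacian h u)"
    unfolding ell2_norm_scale norm_of_real by simp
  also have "\<dots> \<le> 1 / h\<^sup>2 * (4 * real CARD('n) * ell2_norm S u)"
    by (intro mult_left_mono norm_discrete_laplacian_le u) simp
  finally show ?thesis by simp
qed

lemma schroedinger_compact:
  assumes fin: "\<And>M. finite {k\<in>S. \<bar>V k\<bar> \<le> M}"
    and f: "\<And>n. f n \<in> schroedinger_dom h V" "\<And>n. ell2_norm S (f n) \<le> C"
      "\<And>n. ell2_norm S (schroedinger h V (f n)) \<le> C"
  shows "\<exists>(r :: nat \<Rightarrow> nat) g. strict_mono r \<and> g \<in> schroedinger_dom h V \<and>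
    (\<lambda>n. ell2_norm S (\<lambda>k. f (r n) k - g k)) \<longlonglongrightarrow> 0 \<and>
    (\<forall>k. (\<lambda>n. schroedinger h V (f (r n)) k) \<longlonglongrightarrow> schroedinger h V g k)"
proof -
  \<comment> \<open>A common bound for \<open>f n\<close> and its product with \<open>V\<close>, the
    latter by \<open>norm_potential_le\<close>.\<close>
  define C' where "C' = C + 4 * real CARD('n) / h\<^sup>2 * C"
  have f_ell2: "f n \<in> ell2 S" and Vf: "(\<lambda>k. complex_of_real (V k) * f n k) \<in> ell2 S"
    and Hf: "schroedinger h V (f n) \<in> ell2 S" for n
    using f(1)[of n] schroedinger_dom_iff schroedinger_dom_iff_potential by blast+
  have "0 \<le> C" using ell2_norm_nonneg[OF f_ell2[of 0]] f(2)[of 0] by linarith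
  then have "C \<le> C'" by (simp add: C'_def)
  then have f_le: "ell2_norm S (f n) \<le> C'" for n using f(2)[of n] by linarith
  have Vf_le: "ell2_norm S (\<lambda>k. complex_of_real (V k) * f n k) \<le> C'" for n
    using norm_potential_le[OF f(1)[of n]] f(3)[of n]
      mult_left_mono[OF f(2)[of n], of "4 * real CARD('n) / h\<^sup>2"] by (simp add: C'_def)
  obtain r :: "nat \<Rightarrow> nat" and g where r: "strict_mono r" and g: "g \<in> ell2 S"
    and lim: "(\<lambda>n. ell2_norm S (\<lambda>k. f (r n) k - g k)) \<longlonglongrightarrow> 0"
    by (rule ell2_compactness[OF fin f_ell2 f_le Vf Vf_le])
  have "(\<lambda>n. f (r n) k) \<longlonglongrightarrow> g k" for k
    by (rule ell2_tendsto_pointwise[OF f_ell2 g lim])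
  then have H_lim: "(\<lambda>n. schroedinger h V (f (r n)) k) \<longlonglongrightarrow> schroedinger h V g k" for k
    unfolding schroedinger_def by (intro tendsto_intros discrete_laplacian_tendsto)
  \<comment> \<open>The images are bounded in norm and converge pointwise, so Fatou places the limit
    in the domain.\<close>
  have "schroedinger h V g \<in> ell2 S"
    by (rule ell2_Fatou(1)[OF _ H_lim, where C = C]) (use Hf f(3) in simp)
  with g have "g \<in> schroedinger_dom h V" by (simp add: schroedinger_dom_iff)
  with r lim H_lim show ?thesis by blast
qed

end

end

theorem theorem1p2:
  fixes h :: real and V :: "real ^ 'n \<Rightarrow> real"
  assumes "h > 0"
    and "\<forall>k\<in>lattice_points h. V k \<ge> 0"
    and "filterlim (\<lambda>k. \<bar>V k\<bar>) at_top (inf at_infinity (principal (lattice_points h)))"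
  shows "self_adjoint (lattice_points h) (schroedinger_dom h V) (schroedinger h V) \<and>
    purely_discrete_spectrum (lattice_points h) (schroedinger_dom h V) (schroedinger h V)"
proof -
  \<comment> \<open>The growth of \<open>|V|\<close> confines a sublevel set to a ball, which
    contains only finitely many lattice points.\<close>
  have fin: "finite {k\<in>lattice_points h. \<bar>V k\<bar> \<le> M}" for M
  proof -
    obtain b where b: "\<And>k. b \<le> norm k \<Longrightarrow> k \<in> lattice_points h \<Longrightarrow> M < \<bar>V k\<bar>"
      using assms(3) unfolding filterlim_at_top_dense eventually_inf_principal eventually_at_infinity
      by blast
    have "{k\<in>lattice_points h. \<bar>V k\<bar> \<le> M} \<subseteq> {k\<in>lattice_points h. norm k \<le> b}"
      using b linorder_le_cases not_le by blast
    then show ?thesis using finite_lattice_points_cball[OF assms(1)] finite_subset by blast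
  qed
  interpret compact_self_adjoint "lattice_points h" "schroedinger_dom h V" "schroedinger h V"
    by unfold_locales
      (intro schroedinger_self_adjoint countable_lattice_points schroedinger_compact fin; assumption)+
  show ?thesis using self_adjoint purely_discrete by blast
qed

end
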